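(* Let $B$ be a Boolean $\sigma$-algebra. Then $B$ is a measure algebra if and only if $B$ is weakly distributive and there is a countable family $\{C_n\}_{n=1}^\infty$ of subsets of $B^+$ with $B^+=\bigcup_{n=1}^\infty C_n$ such that (i) for every $n$ there is an integer $K(n)$ such that every antichain contained in $C_n$ has at most $K(n)$ elements; and (ii) if $\{a_n\}_{n=1}^\infty$ is a sequence in $B$ with $a_n\notin C_n$ for each $n$, then $\lim_n a_n=\mathbf 0$.
   Context: A Boolean algebra $B$ is an algebra of subsets of a nonempty set $X$ with operations $a\cup b$, $a\cap b$, $-a=X-a$, zero $\mathbf 0=\emptyset$ and unit $\mathbf 1=X$ (so $\mathbf 0\neq\mathbf 1$), ordered by inclusion. $B$ is a Boolean $\sigma$-algebra if every countable $A\subset B$ has a supremum $\bigvee A$ and an infimum $\bigwedge A$ in the ordering of $B$. $B^+=B-\{\mathbf 0\}$. A measure on a Boolean $\sigma$-algebra $B$ is a real-valued function $m$ on $B$ with: $m(\mathbf 0)=0$, $m(a)>0$ for $a\ne\mathbf 0$, $m(\mathbf 1)=1$; $m(a)\le m(b)$ if $a\subset b$; $m(a\cup b)=m(a)+m(b)$ if $a\cap b=\mathbf 0$; and $m(\bigvee_{n=1}^\infty a_n)=\sum_{n=1}^\infty m(a_n)$ whenever the $a_n$ are pairwise disjoint. A measure algebra is a Boolean $\sigma$-algebra that carries a measure. An antichain is a set $A\subset B^+$ such that $a\cap b=\mathbf 0$ for all distinct $a,b\in A$. A partition (of $\mathbf 1$) is a maximal antichain, i.e. an antichain with supremum $\mathbf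 1$. $B$ is weakly distributive if for every sequence $\{W_n\}_n$ of partitions there is a partition $W$ such that each $a\in W$ meets (has nonzero intersection with) only finitely many elements of each $W_n$. For a sequence $\{a_n\}_n$ in a Boolean $\sigma$-algebra, $\limsup_n a_n=\bigwedge_{n=1}^\infty\bigvee_{k=n}^\infty a_k$ and $\liminf_n a_n=\bigvee_{n=1}^\infty\bigwedge_{k=n}^\infty a_k$; $\lim_n a_n=a$ means $\limsup_n a_n=\liminf_n a_n=a$. *)

theory Defs
  imports "HOL-Analysis.Analysis" "HOL-Library.Lub_Glb"
begin

text \<open>
  A Boolean algebra is an algebra \<open>B\<close> of subsets of a nonempty set \<open>X\<close>, with zero \<open>{}\<close>, unit \<open>X\<close>
  and inclusion as ordering. Countable suprema and infima are taken in the ordering of \<open>B\<close>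
  (relative to \<open>B\<close>); in general they differ from unions and intersections.
\<close>

definition boolean_sigma_algebra :: "'a set \<Rightarrow> 'a set set \<Rightarrow> bool" where
  "boolean_sigma_algebra X B \<longleftrightarrow>
     X \<noteq> {} \<and> algebra X B \<and>
     (\<forall>A. A \<subseteq> B \<and> countable A \<longrightarrow> (\<exists>s. isLub B A s) \<and> (\<exists>i. isGlb B A i))"

definition bsup :: "'a set set \<Rightarrow> 'a set set \<Rightarrow> 'a set" where
  "bsup B A = (THE s. isLub B A s)"

definition binf :: "'a set set \<Rightarrow> 'a set set \<Rightarrow> 'a set" where
  "binf B A = (THE i. isGlb B A i)"

lemma isLub_bsup:
  assumes "boolean_sigma_algebra X B" "A \<subseteq> B" "countable A"
  shows "isLub B A (bsup B A)"
proof -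
  obtain s where s: "isLub B A s"
    using assms unfolding boolean_sigma_algebra_def by blast
  show ?thesis
    unfolding bsup_def
  proof (rule theI[of _ s])
    show "t = s" if "isLub B A t" for t
      using s that by (auto simp: isLub_def leastP_def setge_def)
  qed (rule s)
qed

lemma isGlb_binf:
  assumes "boolean_sigma_algebra X B" "A \<subseteq> B" "countable A"
  shows "isGlb B A (binf B A)"
proof -
  obtain s where s: "isGlb B A s"
    using assms unfolding boolean_sigma_algebra_def by blast
  show ?thesis
    unfolding binf_def
  proof (rule theI[of _ s])
    show "t = s" if "isGlb B A t" for t
      using s that by (auto simp: isGlb_def greatestP_def setle_def)
  qed (rule s)
qed

definition positive_part :: "'a set set \<Rightarrow> 'a set set" where
  "positive_part B = B - {{}}"

definition measure_on :: "'a set \<Rightarrow> 'a set set \<Rightarrow> ('a set \<Rightarrow> real) \<Rightarrow> bool" where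
  "measure_on X B m \<longleftrightarrow>
     m {} = 0 \<and>
     (\<forall>a\<in>B. a \<noteq> {} \<longrightarrow> m a > 0) \<and>
     m X = 1 \<and>
     (\<forall>a\<in>B. \<forall>b\<in>B. a \<subseteq> b \<longrightarrow> m a \<le> m b) \<and>
     (\<forall>a\<in>B. \<forall>b\<in>B. a \<inter> b = {} \<longrightarrow> m (a \<union> b) = m a + m b) \<and>
     (\<forall>a :: nat \<Rightarrow> 'a set. range a \<subseteq> B \<and> disjoint_family a \<longrightarrow>
        (\<lambda>n. m (a n)) sums m (bsup B (range a)))"

definition measure_algebra :: "'a set \<Rightarrow> 'a set set \<Rightarrow> bool" where
  "measure_algebra X B \<longleftrightarrow> boolean_sigma_algebra X B \<and> (\<exists>m. measure_on X B m)"

definition antichain :: "'a set set \<Rightarrow> 'a set set \<Rightarrow> bool" where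
  "antichain B A \<longleftrightarrow>
     A \<subseteq> positive_part B \<and> (\<forall>a\<in>A. \<forall>b\<in>A. a \<noteq> b \<longrightarrow> a \<inter> b = {})"

definition unit_partition :: "'a set set \<Rightarrow> 'a set set \<Rightarrow> bool" where
  "unit_partition B W \<longleftrightarrow>
     antichain B W \<and> (\<forall>W'. antichain B W' \<and> W \<subseteq> W' \<longrightarrow> W' = W)"

lemma unit_partition_iff_isLub:
  assumes "algebra X B"
  shows "unit_partition B W \<longleftrightarrow> antichain B W \<and> isLub B W X"
proof -
  interpret algebra X B by (rule assms)
  have sub: "a \<subseteq> X" if "a \<in> B" for a
    using that space_closed by blast
  have "isLub B W X" if W: "unit_partition B W"
  proof -
    have "X \<subseteq> u" if u: "u \<in> B" "\<forall>w\<in>W. w \<subseteq> u" for u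
    proof (rule ccontr)
      assume "\<not> X \<subseteq> u"
      then have ne: "X - u \<noteq> {}" by blast
      have AW: "antichain B W"
        using W by (simp add: unit_partition_def)
      have "X - u \<in> B" by (rule compl_sets) (rule u(1))
      moreover have "(X - u) \<inter> w = {}" "w \<inter> (X - u) = {}" if "w \<in> W" for w
        using u(2) that by auto
      ultimately have "antichain B (insert (X - u) W)"
        using AW ne by (simp add: antichain_def positive_part_def)
      then have "insert (X - u) W = W"
        using W unfolding unit_partition_def by (metis subset_insertI)
      then have "X - u \<in> W" by blast
      with u(2) have "X - u \<subseteq> u" by (rule bspec)
      then show False using ne by blast
    qed
    then show ?thesis
      using W sub
      by (auto simp: unit_partition_def antichain_def positive_part_def isLub_def leastP_def
          isUb_def setle_def setge_def)
  qed
  moreover have "unit_partition B W" if W: "antichain B W" and L: "isLub B W X"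
    unfolding unit_partition_def
  proof (intro conjI allI impI W)
    fix W' assume W': "antichain B W' \<and> W \<subseteq> W'"
    have "x \<in> W" if x: "x \<in> W'" for x
    proof (rule ccontr)
      assume nx: "x \<notin> W"
      have xB: "x \<in> B" "x \<noteq> {}"
        using x W' by (auto simp: antichain_def positive_part_def)
      have "isUb B W (X - x)"
        unfolding isUb_def setle_def
      proof (intro conjI ballI)
        show "X - x \<in> B" by (rule compl_sets) (rule xB)
        fix w assume w: "w \<in> W"
        have "w \<in> W'" "w \<noteq> x"
          using w nx W' by auto
        then have "w \<inter> x = {}"
          using x W' by (simp add: antichain_def)
        moreover have "w \<subseteq> X"
          using w W sub by (auto simp: antichain_def positive_part_def)
        ultimately show "w \<subseteq> X - x" by blast
      qed
      then have "X \<subseteq> X - x"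
        using L by (auto simp: isLub_def leastP_def setge_def)
      then show False using xB(2) sub[OF xB(1)] by blast
    qed
    then show "W' = W" using W' by blast
  qed
  ultimately show ?thesis
    unfolding unit_partition_def by blast
qed

definition weakly_distributive :: "'a set set \<Rightarrow> bool" where
  "weakly_distributive B \<longleftrightarrow>
     (\<forall>W :: nat \<Rightarrow> 'a set set. (\<forall>n. unit_partition B (W n)) \<longrightarrow>
        (\<exists>V. unit_partition B V \<and> (\<forall>a\<in>V. \<forall>n. finite {b \<in> W n. a \<inter> b \<noteq> {}})))"

definition blimsup :: "'a set set \<Rightarrow> (nat \<Rightarrow> 'a set) \<Rightarrow> 'a set" where
  "blimsup B a = binf B (range (\<lambda>n. bsup B (a ` {n..})))"

definition bliminf :: "'a set set \<Rightarrow> (nat \<Rightarrow> 'a set) \<Rightarrow> 'a set" where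
  "bliminf B a = bsup B (range (\<lambda>n. binf B (a ` {n..})))"

definition blim :: "'a set set \<Rightarrow> (nat \<Rightarrow> 'a set) \<Rightarrow> 'a set \<Rightarrow> bool" where
  "blim B a l \<longleftrightarrow> blimsup B a = l \<and> bliminf B a = l"

end

theory Submission
  imports Defs
begin

text \<open>
  For a measure \<open>m\<close> take \<open>C n = {a. m a \<ge> 2\<^sup>-\<^sup>n}\<close>. Conversely, weak distributivity allows diagonal
  arguments with sequences converging to zero. They let one shrink the upward closed version of
  \<open>C n\<close> to sets \<open>E n\<close> whose complements absorb all sequences converging to zero, so that whenever a
  union of three elements lies in \<open>E n\<close>, one of them lies in a fixed \<open>E n'\<close>. This splitting
  property and the bound on antichains in \<open>E n'\<close> are all that the argument of Kalton and Roberts needs, so no submeasure has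
  to be constructed: by means of concentrators, \<open>E n\<close> has positive intersection number. As in
  Kelley's theorem this gives a finitely additive measure positive on \<open>E n\<close>, and a mixture of these
  is strictly positive. Replacing \<open>\<mu> a\<close> by the infimum, over sequences increasing to \<open>a\<close>, of the
  limits of \<open>\<mu>\<close> along them makes it countably additive; strict positivity survives by weak
  distributivity.
\<close>

subsection \<open>Bipartite graphs\<close>

text \<open>The number three is the degree of the bipartite graphs used as concentrators. With
  \<open>m\<close> vertices and \<open>l\<close> targets there are at most
  \<open>(9 * m * l / i^2)^i\<close> pairs of sets of size \<open>i\<close>, and random choices of
  \<open>d\<close> neighbours confine the first set to the second with probability
  \<open>(i / l)^(d * i)\<close>. For \<open>d = 2\<close> the base of the product is
  \<open>9 * m / l\<close>, which is not small because \<open>l\<close> stays below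
  \<open>m\<close>; for \<open>d = 3\<close> it is \<open>9 * m * i / l^2\<close>, which is small
  for small \<open>i\<close>. Hence elements have to be cut into three pieces, and splitting into
  three is what the sets \<open>E n\<close> must support. The obstacle throughout is that countable
  suprema in \<open>B\<close> need not be unions. Points of \<open>X\<close> are therefore
  confronted with only finitely many sets at a time, in the intersection number, and each infinite
  operation is expressed through bounds that belong to \<open>B\<close>. Weak distributivity enters
  through a single diagonal lemma, whose enumeration of a partition relies on the countability of
  antichains; the latter comes from the bounds on antichains.\<close>

lemma hall_marriage:
  fixes N :: "'i \<Rightarrow> 'j set"
  assumes "finite I" "\<And>i. i \<in> I \<Longrightarrow> finite (N i)"
    and "\<And>S. S \<subseteq> I \<Longrightarrow> card S \<le> card (\<Union>(N ` S))"
  shows "\<exists>f. inj_on f I \<and> (\<forall>i\<in>I. f i \<in> N i)"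
  using assms
proof (induction "card I" arbitrary: I N rule: less_induct)
  case less
  note fin = less.prems(1,2) and hall = less.prems(3)
  show ?case
  \<comment> \<open>A tight set \<open>S\<close> may use up its whole neighbourhood:
    \<open>S \<union> T\<close> has enough neighbours and \<open>S\<close> accounts for exactly
    \<open>card S\<close> of them, so Hall's condition survives for the remaining vertices. If no
    nonempty proper subset is tight, each has a neighbour to spare, and an arbitrary edge can be
    fixed.\<close>
  proof (cases "\<exists>S. S \<subset> I \<and> S \<noteq> {} \<and> card (\<Union>(N ` S)) = card S")
    case True
    then obtain S where S: "S \<subset> I" "S \<noteq> {}" "card (\<Union>(N ` S)) = card S" by blast
    have finS: "finite S" using S fin finite_subset by blast
    have "card S < card I" using S fin by (simp add: psubset_card_mono)
    then have "\<exists>f. inj_on f S \<and> (\<forall>i\<in>S. f i \<in> N i)"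
      by (rule less.hyps) (use S fin hall finS in auto)
    then obtain f where f: "inj_on f S" "\<forall>i\<in>S. f i \<in> N i" by blast
    let ?N = "\<lambda>i. N i - \<Union>(N ` S)"
    have "\<exists>g. inj_on g (I - S) \<and> (\<forall>i\<in>I - S. g i \<in> ?N i)"
    proof (rule less.hyps)
      show "card (I - S) < card I"
        using S fin by (intro psubset_card_mono) auto
      show "card T \<le> card (\<Union>(?N ` T))" if T: "T \<subseteq> I - S" for T
      proof -
        have finT: "finite T" using T fin finite_subset by blast
        have "card S + card T = card (S \<union> T)"
          using T finS finT by (intro card_Un_disjoint[symmetric]) auto
        also have "\<dots> \<le> card (\<Union>(N ` (S \<union> T)))" using S T by (intro hall) auto
        also have "\<Union>(N ` (S \<union> T)) = \<Union>(N ` S) \<union> \<Union>(?N ` T)" by auto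
        also have "card \<dots> \<le> card (\<Union>(N ` S)) + card (\<Union>(?N ` T))" by (rule card_Un_le)
        finally show ?thesis using S by simp
      qed
    qed (use fin in auto)
    then obtain g where g: "inj_on g (I - S)" "\<forall>i\<in>I - S. g i \<in> ?N i" by blast
    define h where "h i = (if i \<in> S then f i else g i)" for i
    have "inj_on h (S \<union> (I - S))"
      unfolding h_def
    proof (rule inj_on_disjoint_Un)
      have "f i \<noteq> g j" if "i \<in> S" "j \<in> I - S" for i j
        using bspec[OF f(2) that(1)] bspec[OF g(2) that(2)] that(1) by auto
      then show "f ` S \<inter> g ` (I - S) = {}"
        by (intro equals0I) (elim IntE imageE, simp)
    qed (simp_all add: f(1) g(1))
    moreover have "S \<union> (I - S) = I" using S by blast
    ultimately have "inj_on h I" by simp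
    moreover have "\<forall>i\<in>I. h i \<in> N i" using f g by (auto simp: h_def)
    ultimately show ?thesis by blast
  next
    case False
    show ?thesis
    proof (cases "I = {}")
      case False
      then obtain i where i: "i \<in> I" by blast
      have "card {i} \<le> card (\<Union>(N ` {i}))" using i by (intro hall) auto
      then have "N i \<noteq> {}" by auto
      then obtain y where y: "y \<in> N i" by blast
      let ?N = "\<lambda>j. N j - {y}"
      have "\<exists>g. inj_on g (I - {i}) \<and> (\<forall>j\<in>I - {i}. g j \<in> ?N j)"
      proof (rule less.hyps)
        show "card (I - {i}) < card I" using fin(1) i by (rule card_Diff1_less)
        show "card T \<le> card (\<Union>(?N ` T))" if T: "T \<subseteq> I - {i}" for T
        proof (cases "T = {}")
          case False
          have "T \<subset> I" using T i by blast
          then have "card (\<Union>(N ` T)) \<noteq> card T" "card T \<le> card (\<Union>(N ` T))"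
            using \<open>\<not> (\<exists>S. S \<subset> I \<and> S \<noteq> {} \<and> card (\<Union>(N ` S)) = card S)\<close> False hall by auto
          moreover have "\<Union>(?N ` T) = \<Union>(N ` T) - {y}" by auto
          moreover have "card (\<Union>(N ` T) - {y}) \<ge> card (\<Union>(N ` T)) - 1"
            using diff_card_le_card_Diff[of "{y}"] by simp
          ultimately show ?thesis by simp
        qed simp
      qed (use fin in auto)
      then obtain g where g: "inj_on g (I - {i})" "\<forall>j\<in>I - {i}. g j \<in> ?N j" by blast
      have "inj_on (g(i := y)) I"
        using g i unfolding inj_on_def by auto
      moreover have "\<forall>j\<in>I. (g(i := y)) j \<in> N j" using g y by auto
      ultimately show ?thesis by blast
    qed simp
  qed
qed

section \<open>Concentrators of degree three by counting\<close>

lemma binomial_le_exp_bound: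
  assumes "0 < i"
  shows "real (m choose i) \<le> (3 * real m / real i) ^ i"
proof -
  \<comment> \<open>A single term of the series of \<open>exp i\<close>. It allows \<open>i!\<close>
    to be replaced by \<open>(i / 3) ^ i\<close>, with \<open>e\<close> rounded up to 3.\<close>
  have "real i ^ i / fact i \<le> exp (real i)"
    using sum_le_suminf[OF summable_exp_generic[of "real i"], of "{i}"]
    by (simp add: exp_def divide_inverse mult.commute)
  also have "\<dots> = exp 1 ^ i" using exp_of_nat_mult[of i "1::real"] by simp
  also have "\<dots> \<le> 3 ^ i" using exp_le by (intro power_mono) auto
  finally have *: "real i ^ i / fact i \<le> 3 ^ i" .
  have "real (m choose i) \<le> real m ^ i / fact i"
  proof -
    have "real ((m choose i) * fact i) \<le> real (m ^ i)"
      using binomial_fact_pow by (rule of_nat_mono)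
    then show ?thesis by (simp add: pos_le_divide_eq)
  qed
  also have "\<dots> = (real m / real i) ^ i * (real i ^ i / fact i)"
    using assms by (simp add: field_simps)
  also have "\<dots> \<le> (real m / real i) ^ i * 3 ^ i" by (intro mult_left_mono *) auto
  also have "\<dots> = (3 * real m / real i) ^ i" by (simp add: power_mult_distrib field_simps)
  finally show ?thesis .
qed

text \<open>Random neighbours are handled by counting: a choice function has \<open>d\<close>
  coordinates for every vertex, and the constraint shrinks the factors over \<open>I\<close> from
  \<open>L\<close> to \<open>J\<close> in a product set.\<close>

lemma card_funcset_constrained:
  assumes "finite M" "finite L" "I \<subseteq> M" "J \<subseteq> L"
  shows "card {h \<in> (M \<times> {..<d}) \<rightarrow>\<^sub>E L. h ` (I \<times> {..<d}) \<subseteq> J} =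
    card J ^ (d * card I) * card L ^ (d * (card M - card I))"
proof -
  let ?S = "\<lambda>p. if fst p \<in> I then J else L"
  have "{h \<in> (M \<times> {..<d}) \<rightarrow>\<^sub>E L. h ` (I \<times> {..<d}) \<subseteq> J} = Pi\<^sub>E (M \<times> {..<d}) ?S"
  proof (intro equalityI subsetI)
    fix h assume h: "h \<in> {h \<in> (M \<times> {..<d}) \<rightarrow>\<^sub>E L. h ` (I \<times> {..<d}) \<subseteq> J}"
    show "h \<in> Pi\<^sub>E (M \<times> {..<d}) ?S"
    proof (rule PiE_I)
      fix p assume p: "p \<in> M \<times> {..<d}"
      have "h p \<in> J" if "fst p \<in> I"
        using h p that by (auto simp: image_subset_iff)
      moreover have "h p \<in> L" using h p by (auto dest: PiE_mem)
      ultimately show "h p \<in> ?S p" by simp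
    next
      show "h p = undefined" if "p \<notin> M \<times> {..<d}" for p
        using h that PiE_arb by blast
    qed
  next
    fix h assume h: "h \<in> Pi\<^sub>E (M \<times> {..<d}) ?S"
    have "h p \<in> L" if "p \<in> M \<times> {..<d}" for p
      using PiE_mem[OF h that] assms(4) by (auto split: if_splits)
    moreover have "h p \<in> J" if "p \<in> I \<times> {..<d}" for p
      using PiE_mem[OF h, of p] that assms(3) by auto
    moreover have "h p = undefined" if "p \<notin> M \<times> {..<d}" for p
      using PiE_arb[OF h that] .
    ultimately show "h \<in> {h \<in> (M \<times> {..<d}) \<rightarrow>\<^sub>E L. h ` (I \<times> {..<d}) \<subseteq> J}"
      unfolding PiE_def extensional_def Pi_def by blast
  qed
  moreover have "card (Pi\<^sub>E (M \<times> {..<d}) ?S) = (\<Prod>i\<in>M. \<Prod>t<d. card (if i \<in> I then J else L))"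
    using assms(1) by (simp add: card_PiE prod.cartesian_product case_prod_unfold del: prod_constant)
  moreover have "\<dots> = (\<Prod>i\<in>M. if i \<in> I then card J ^ d else card L ^ d)"
    by (intro prod.cong) auto
  moreover have "\<dots> = (\<Prod>i\<in>I. card J ^ d) * (\<Prod>i\<in>M - I. card L ^ d)"
    using assms by (simp add: prod.If_cases Int_absorb1 Diff_eq)
  moreover have "card (M - I) = card M - card I"
    using assms finite_subset by (metis card_Diff_subset)
  ultimately show ?thesis by (simp add: power_mult)
qed

text \<open>If every vertex of \<open>M\<close> picks three neighbours at random, the expected number of pairs
  \<open>(I, J)\<close> of sets of the same size \<open>i \<le> k\<close> such that \<open>I\<close> has all its neighbours in \<open>J\<close> is at most the sum
  of the \<open>4\<^sup>-\<^sup>i\<close>, hence less than one.\<close>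

lemma concentrator_exists:
  fixes M :: "'i set"
  assumes M: "finite M" and kl: "k \<le> l" and l: "0 < l" and big: "36 * card M * k \<le> l\<^sup>2"
  shows "\<exists>g :: 'i \<Rightarrow> nat \<Rightarrow> nat. (\<forall>i\<in>M. \<forall>t<3. g i t < l) \<and>
    (\<forall>I\<subseteq>M. card I \<le> k \<longrightarrow> card I \<le> card (\<Union>i\<in>I. g i ` {..<3}))"
proof (rule ccontr)
  assume no: "\<not> ?thesis"
  define m where "m = card M"
  define H where "H = (M \<times> {..<3::nat}) \<rightarrow>\<^sub>E {..<l}"
  define bad where "bad I J = {h \<in> H. h ` (I \<times> {..<3}) \<subseteq> J}" for I J
  define P where "P i = {I. I \<subseteq> M \<and> card I = i} \<times> {J. J \<subseteq> {..<l} \<and> card J = i}" for i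
  have finH: "finite H" unfolding H_def using M by (intro finite_PiE) auto
  have finP: "finite (P i)" for i unfolding P_def using M by auto
  have cardP: "card (P i) = (m choose i) * (l choose i)" for i
    unfolding P_def m_def using M by (simp add: card_cartesian_product n_subsets)
  have cardH: "card H = l ^ (3 * m)"
    unfolding H_def m_def using M by (simp add: card_funcsetE mult.commute)
  have cover: "H \<subseteq> (\<Union>i\<in>{1..k}. \<Union>p\<in>P i. bad (fst p) (snd p))"
  proof
    fix h assume h: "h \<in> H"
    have "\<forall>i\<in>M. \<forall>t<3. h (i, t) < l" using h by (auto simp: H_def)
    moreover have "\<not> ((\<forall>i\<in>M. \<forall>t<3. h (i, t) < l) \<and>
      (\<forall>I\<subseteq>M. card I \<le> k \<longrightarrow> card I \<le> card (\<Union>i\<in>I. (\<lambda>t. h (i, t)) ` {..<3})))"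
      using no by (rule contrapos_nn) (rule exI)
    ultimately obtain I where I: "I \<subseteq> M" "card I \<le> k"
      "card (\<Union>i\<in>I. (\<lambda>t. h (i, t)) ` {..<3}) < card I"
      by (auto simp: not_le)
    define J0 where "J0 = h ` (I \<times> {..<3})"
    have J0: "J0 = (\<Union>i\<in>I. (\<lambda>t. h (i, t)) ` {..<3})" unfolding J0_def by auto
    have sub: "J0 \<subseteq> {..<l}" using h I by (auto simp: J0_def H_def)
    \<comment> \<open>A neighbourhood that is too small is padded to exactly \<open>card I\<close>
      targets, so that only pairs of equal size have to be counted; \<open>k \<le> l\<close> leaves
      room for this.\<close>
    have "card J0 \<le> card I" "card I \<le> card {..<l}" using I kl J0 by auto
    then obtain J where J: "J0 \<subseteq> J" "J \<subseteq> {..<l}" "card J = card I"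
      using exists_subset_between[OF _ _ sub] by blast
    have "h \<in> bad I J" using h J by (auto simp: bad_def J0_def)
    moreover have "(I, J) \<in> P (card I)" using I J by (auto simp: P_def)
    moreover have "card I \<in> {1..k}" using I by auto
    ultimately show "h \<in> (\<Union>i\<in>{1..k}. \<Union>p\<in>P i. bad (fst p) (snd p))" by fastforce
  qed
  have card_bad: "real (card (bad (fst p) (snd p))) = real l ^ (3 * m) * (real i / real l) ^ (3 * i)"
    if p: "p \<in> P i" for i p
  proof -
    have im: "i \<le> m" using p M by (auto simp: P_def m_def card_mono)
    have "card (bad (fst p) (snd p)) = i ^ (3 * i) * l ^ (3 * (m - i))"
      using card_funcset_constrained[of M "{..<l}" "fst p" "snd p" 3] p M
      by (auto simp: P_def bad_def H_def m_def)
    moreover have "real l ^ (3 * m) = real l ^ (3 * (m - i)) * real l ^ (3 * i)"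
      using im by (simp flip: power_add add: algebra_simps)
    ultimately show ?thesis using l by (simp add: power_divide)
  qed
  have estimate: "real (card (P i)) * (real i / real l) ^ (3 * i) \<le> (1 / 4) ^ i" if i: "i \<in> {1..k}" for i
  proof -
    have i0: "0 < i" using i by auto
    have "real (card (P i)) * (real i / real l) ^ (3 * i) \<le>
      ((3 * real m / real i) ^ i * (3 * real l / real i) ^ i) * (real i / real l) ^ (3 * i)"
      unfolding cardP of_nat_mult
      by (intro mult_right_mono mult_mono binomial_le_exp_bound i0) auto
    also have "\<dots> = ((3 * real m / real i) * (3 * real l / real i) * (real i / real l) ^ 3) ^ i"
      by (simp only: power_mult power_mult_distrib[symmetric])
    also have "(3 * real m / real i) * (3 * real l / real i) * (real i / real l) ^ 3 =
        9 * real m * real i / (real l)\<^sup>2"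
      using i0 l by (simp add: field_simps power2_eq_square power3_eq_cube)
    \<comment> \<open>The 36 of the hypothesis is 4 times the 9 of the two binomial estimates; with
      ratio 1/4 the geometric sum from 1 on is at most 1/3.\<close>
    also have "(9 * real m * real i / (real l)\<^sup>2) ^ i \<le> (1 / 4) ^ i"
    proof (intro power_mono)
      have "36 * (m * i) \<le> 36 * (m * k)" using i by simp
      also have "\<dots> \<le> l\<^sup>2" using big by (simp add: m_def mult.assoc)
      finally have "real (36 * (m * i)) \<le> real (l\<^sup>2)" by (rule of_nat_mono)
      then have "9 * real m * real i \<le> 1 / 4 * (real l)\<^sup>2" by simp
      then show "9 * real m * real i / (real l)\<^sup>2 \<le> 1 / 4"
        using l by (subst pos_divide_le_eq) auto
    qed auto
    finally show ?thesis .
  qed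
  have "card H \<le> card (\<Union>i\<in>{1..k}. \<Union>p\<in>P i. bad (fst p) (snd p))"
    using finP finH by (intro card_mono cover) (auto simp: bad_def)
  also have "\<dots> \<le> (\<Sum>i\<in>{1..k}. card (\<Union>p\<in>P i. bad (fst p) (snd p)))" by (rule card_UN_le) simp
  also have "\<dots> \<le> (\<Sum>i\<in>{1..k}. \<Sum>p\<in>P i. card (bad (fst p) (snd p)))"
    by (intro sum_mono card_UN_le finP)
  finally have "real l ^ (3 * m) \<le> real (\<Sum>i\<in>{1..k}. \<Sum>p\<in>P i. card (bad (fst p) (snd p)))"
    unfolding cardH using of_nat_mono by fastforce
  also have "\<dots> = real l ^ (3 * m) * (\<Sum>i\<in>{1..k}. real (card (P i)) * (real i / real l) ^ (3 * i))"
    by (simp add: card_bad sum_distrib_left mult_ac)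
  also have "\<dots> \<le> real l ^ (3 * m) * (\<Sum>i\<in>{1..k}. (1 / 4) ^ i)"
    by (intro mult_left_mono sum_mono estimate) auto
  also have "(\<Sum>i\<in>{1..k}. (1 / 4 :: real) ^ i) \<le> 1 / 3"
    using sum_gp[of "1/4::real" 1 k] by (auto simp: field_simps)
  then have "real l ^ (3 * m) * (\<Sum>i\<in>{1..k}. (1 / 4) ^ i) \<le> real l ^ (3 * m) * (1 / 3)"
    by (intro mult_left_mono) auto
  finally show False using l by simp
qed

subsection \<open>Charges from intersection numbers\<close>

text \<open>If every point lay in at most \<open>k\<close> of the \<open>a i\<close>, Hall's theorem
  would match the indices at each point injectively to neighbours in a concentrator. Sorting the
  points of \<open>a i\<close> by the neighbour that \<open>i\<close> receives cuts
  \<open>a i\<close> into three pieces, one of which is in \<open>D\<close>. Chosen pieces with the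
  same target are disjoint by injectivity, so each of the \<open>l\<close> targets serves at most
  \<open>r\<close> indices; but \<open>l * r\<close> is less than \<open>card I\<close>.\<close>

lemma kalton_roberts_intersection:
  fixes a :: "'i \<Rightarrow> 'a set"
  assumes alg: "algebra X B"
    and bound: "\<And>A. antichain B A \<Longrightarrow> A \<subseteq> D \<Longrightarrow> finite A \<and> card A \<le> r"
    and D: "D \<subseteq> positive_part B" and C: "C \<subseteq> B"
    and split: "\<And>c1 c2 c3. c1 \<in> B \<Longrightarrow> c2 \<in> B \<Longrightarrow> c3 \<in> B \<Longrightarrow> c1 \<union> c2 \<union> c3 \<in> C \<Longrightarrow>
      c1 \<in> D \<or> c2 \<in> D \<or> c3 \<in> D"
    and I: "finite I" "I \<noteq> {}" and a: "\<And>i. i \<in> I \<Longrightarrow> a i \<in> C"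
  shows "\<exists>x\<in>X. card I \<le> 576 * (Suc r)\<^sup>2 * card {i \<in> I. x \<in> a i}"
proof (rule ccontr)
  interpret algebra X B by (rule alg)
  assume "\<not> ?thesis"
  then have few: "576 * (Suc r)\<^sup>2 * card {i \<in> I. x \<in> a i} < card I" if "x \<in> X" for x
    using that by (auto simp: not_le)
  define m where "m = card I"
  define R where "R = Suc r"
  \<comment> \<open>The factor is \<open>36 * 16\<close>: the concentrator asks for
    \<open>36 * m * k \<le> l\<^sup>2\<close>, and \<open>m \<le> 4 * R * l\<close> costs
    \<open>16 * R\<^sup>2\<close>. With \<open>R = r + 1\<close> the final count
    \<open>l * r < l * R\<close> is strict even for \<open>r = 0\<close>.\<close>
  define q where "q = 576 * R\<^sup>2"
  define k where "k = m div q"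
  define l where "l = m div (2 * R)"
  define occ where "occ x = {i \<in> I. x \<in> a i}" for x
  have aB: "a i \<in> B" if "i \<in> I" for i using a C that by blast
  have aX: "a i \<subseteq> X" if "i \<in> I" for i using aB[OF that] space_closed by blast
  have occ_le: "card (occ x) \<le> k" if "x \<in> X" for x
  proof -
    have "q * card (occ x) \<le> m"
      using few[OF that] by (simp add: q_def R_def m_def occ_def)
    then show ?thesis
      unfolding k_def by (simp add: less_eq_div_iff_mult_less_eq q_def R_def mult.commute)
  qed
  \<comment> \<open>This keeps \<open>l\<close> positive. Splitting into three equal pieces puts
    \<open>a i\<close> itself in \<open>D\<close>, so it has a point, and the bound on the
    occurrences of that point forces \<open>m\<close> above \<open>q\<close>.\<close>
  have qm: "q \<le> m"
  proof -
    obtain i where i: "i \<in> I" using I by blast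
    have "a i \<in> D" using split[of "a i" "a i" "a i"] a[OF i] aB[OF i] by auto
    then obtain x where x: "x \<in> a i" using D by (auto simp: positive_part_def)
    then have "0 < card (occ x)" using i I by (auto simp: occ_def card_gt_0_iff)
    then have "q \<le> q * card (occ x)" by simp
    also have "\<dots> < m"
      using few[of x] aX[OF i] x by (auto simp: q_def R_def m_def occ_def)
    finally show ?thesis by simp
  qed
  have R0: "0 < R" by (simp add: R_def)
  have q0: "0 < q" using R0 by (simp add: q_def)
  have Rq: "2 * R \<le> q" using R0 by (simp add: q_def power2_eq_square)
  then have l0: "0 < l" using qm R0 by (simp add: l_def div_greater_zero_iff)
  have kl: "k \<le> l" unfolding k_def l_def using Rq R0 by (intro div_le_mono2) auto
  have lm: "l * (2 * R) \<le> m" by (simp add: l_def)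
  have "m < 2 * R * Suc l"
    unfolding l_def using R0
    by (metis dividend_less_times_div mult_pos_pos mult_Suc_right zero_less_numeral add.commute)
  also have "\<dots> \<le> 4 * R * l" using l0 by simp
  finally have ml: "m \<le> 4 * R * l" by simp
  have "36 * m * k * (16 * R\<^sup>2) = m * (k * q)" by (simp add: q_def)
  also have "\<dots> \<le> m * m" by (simp add: k_def)
  also have "\<dots> \<le> (4 * R * l) * (4 * R * l)" using ml by (intro mult_mono) auto
  also have "\<dots> = l\<^sup>2 * (16 * R\<^sup>2)" by (simp add: power2_eq_square)
  finally have "36 * card I * k \<le> l\<^sup>2" using R0 by (simp add: m_def mult_ac)
  from concentrator_exists[OF I(1) kl l0 this] obtain g :: "'i \<Rightarrow> nat \<Rightarrow> nat" where
    g: "\<And>i t. i \<in> I \<Longrightarrow> t < 3 \<Longrightarrow> g i t < l" and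
    expand: "\<And>S. S \<subseteq> I \<Longrightarrow> card S \<le> k \<Longrightarrow> card S \<le> card (\<Union>i\<in>S. g i ` {..<3})"
    by blast
  have "\<exists>f. inj_on f S \<and> (\<forall>i\<in>S. f i \<in> g i ` {..<3})" if S: "S \<subseteq> I" "card S \<le> k" for S
  proof (rule hall_marriage)
    show "finite S" using S I finite_subset by blast
    then show "card T \<le> card (\<Union>i\<in>T. g i ` {..<3})" if "T \<subseteq> S" for T
      using S that card_mono[of S T] by (intro expand) auto
  qed simp
  then obtain f where
    f: "\<And>S. S \<subseteq> I \<Longrightarrow> card S \<le> k \<Longrightarrow> inj_on (f S) S \<and> (\<forall>i\<in>S. f S i \<in> g i ` {..<3})"
    by metis
  \<comment> \<open>The piece of \<open>a i\<close> on which \<open>i\<close> is matched to its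
    neighbour number \<open>t\<close>. The matching depends on \<open>x\<close> only through
    \<open>occ x\<close>, which takes finitely many values; this is why the pieces stay in the
    algebra.\<close>
  define c where "c i t = {x \<in> a i. f (occ x) i = g i t}" for i t
  have cB: "c i t \<in> B" if i: "i \<in> I" for i t
  proof -
    have E: "{x \<in> X. occ x = S} \<in> B" if S: "S \<subseteq> I" for S
    proof -
      have "{x \<in> X. x \<in> a j \<longleftrightarrow> j \<in> S} \<in> B" if j: "j \<in> I" for j
      proof (cases "j \<in> S")
        case True
        then have "{x \<in> X. x \<in> a j \<longleftrightarrow> j \<in> S} = a j" using aX[OF j] by auto
        then show ?thesis using aB[OF j] by simp
      next
        case False
        then have "{x \<in> X. x \<in> a j \<longleftrightarrow> j \<in> S} = X - a j" by auto
        then show ?thesis using aB[OF j] compl_sets by simp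
      qed
      then have "{x \<in> X. \<forall>j\<in>I. x \<in> a j \<longleftrightarrow> j \<in> S} \<in> B"
        using I by (intro sets_Collect_finite_All) auto
      moreover have "{x \<in> X. occ x = S} = {x \<in> X. \<forall>j\<in>I. x \<in> a j \<longleftrightarrow> j \<in> S}"
        using S by (auto simp: occ_def)
      ultimately show ?thesis by simp
    qed
    have "a i \<inter> (\<Union>S\<in>{S \<in> Pow I. f S i = g i t}. {x \<in> X. occ x = S}) \<in> B"
      using I E aB[OF i] by (intro Int finite_UN) auto
    moreover have "c i t = a i \<inter> (\<Union>S\<in>{S \<in> Pow I. f S i = g i t}. {x \<in> X. occ x = S})"
      using aX[OF i] by (auto simp: c_def occ_def)
    ultimately show ?thesis by simp
  qed
  have "\<exists>t<3. c i t \<in> D" if i: "i \<in> I" for i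
  proof -
    have "\<exists>t<3. x \<in> c i t" if x: "x \<in> a i" for x
    proof -
      have "occ x \<subseteq> I" "i \<in> occ x" using i x by (auto simp: occ_def)
      moreover have "card (occ x) \<le> k" using occ_le aX[OF i] x by blast
      ultimately have "f (occ x) i \<in> g i ` {..<3}" using f by blast
      then show ?thesis using x by (auto simp: c_def)
    qed
    then have "a i = c i 0 \<union> c i 1 \<union> c i 2"
      by (auto simp: c_def less_Suc_eq numeral_3_eq_3 numeral_2_eq_2)
    then have "c i 0 \<in> D \<or> c i 1 \<in> D \<or> c i 2 \<in> D"
      using split[of "c i 0" "c i 1" "c i 2"] cB[OF i] a[OF i] by auto
    then show ?thesis by (auto intro: exI[of _ "0::nat"] exI[of _ "1::nat"] exI[of _ "2::nat"])
  qed
  then obtain t where t: "\<And>i. i \<in> I \<Longrightarrow> t i < 3 \<and> c i (t i) \<in> D" by metis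
  define J where "J j = {i \<in> I. g i (t i) = j}" for j
  have J: "card (J j) \<le> r" for j
  proof -
    have disj: "c i (t i) \<inter> c i' (t i') = {}" if "i \<in> J j" "i' \<in> J j" "i \<noteq> i'" for i i'
    proof (rule equals0I)
      fix x assume x: "x \<in> c i (t i) \<inter> c i' (t i')"
      have ii: "i \<in> I" "i' \<in> I" using that by (auto simp: J_def)
      have "x \<in> X" using x aX ii by (auto simp: c_def)
      have "inj_on (f (occ x)) (occ x)"
        using f[of "occ x"] occ_le[OF \<open>x \<in> X\<close>] by (auto simp: occ_def)
      moreover have "f (occ x) i = f (occ x) i'" "i \<in> occ x" "i' \<in> occ x"
        using x that by (auto simp: c_def J_def occ_def)
      ultimately show False using that(3) by (auto dest: inj_onD)
    qed
    have ne: "c i (t i) \<noteq> {}" if "i \<in> I" for i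
      using t[OF that] D by (auto simp: positive_part_def)
    have inj: "inj_on (\<lambda>i. c i (t i)) (J j)"
    proof (rule inj_onI, rule ccontr)
      fix i i' assume *: "i \<in> J j" "i' \<in> J j" "c i (t i) = c i' (t i')" "i \<noteq> i'"
      then have "c i (t i) = {}" using disj[of i i'] by simp
      then show False using ne[of i] * by (simp add: J_def)
    qed
    have "antichain B ((\<lambda>i. c i (t i)) ` J j)" "(\<lambda>i. c i (t i)) ` J j \<subseteq> D"
      unfolding antichain_def using t D disj by (fastforce simp: J_def)+
    then have "card ((\<lambda>i. c i (t i)) ` J j) \<le> r" using bound by blast
    then show ?thesis using inj by (simp add: card_image)
  qed
  have "I = (\<Union>j<l. J j)" using g t by (auto simp: J_def)
  then have "m \<le> (\<Sum>j<l. card (J j))" unfolding m_def by (metis card_UN_le finite_lessThan)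
  also have "\<dots> \<le> (\<Sum>j<l. r)" by (intro sum_mono J)
  also have "\<dots> < l * R" using l0 by (simp add: R_def)
  also have "\<dots> \<le> m" using lm by simp
  finally show False by simp
qed

text \<open>Blackwell's approachability argument replaces the minimax theorem: picking each new point
  against the positive parts of the current deficits keeps the sum of their squares linear in time.\<close>

lemma approachability_potential:
  fixes F :: "'a set set" and q :: int
  assumes F: "finite F" and X: "X \<noteq> {}" and q: "q \<ge> 1"
    and inter: "\<And>w. \<exists>x\<in>X. (\<Sum>a\<in>F. int (w a)) \<le> q * (\<Sum>a\<in>F. of_bool (x \<in> a) * int (w a))"
  shows "\<exists>x :: nat \<Rightarrow> 'a. range x \<subseteq> X \<and>
    (\<Sum>a\<in>F. (max 0 (\<Sum>t<T. 1 - q * of_bool (x t \<in> a)))\<^sup>2) \<le> q\<^sup>2 * card F * T"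
proof (induction T)
  case 0
  then show ?case using X by auto
next
  case (Suc T)
  then obtain x where x: "range x \<subseteq> X"
    "(\<Sum>a\<in>F. (max 0 (\<Sum>t<T. 1 - q * of_bool (x t \<in> a)))\<^sup>2) \<le> q\<^sup>2 * card F * T" by blast
  define S where "S a = (\<Sum>t<T. 1 - q * of_bool (x t \<in> a))" for a
  obtain y where y: "y \<in> X"
    "(\<Sum>a\<in>F. int (nat (S a))) \<le> q * (\<Sum>a\<in>F. of_bool (y \<in> a) * int (nat (S a)))"
    using inter[of "\<lambda>a. nat (S a)"] by blast
  define d where "d a = 1 - q * of_bool (y \<in> a)" for a
  \<comment> \<open>This is the cross term of the expanded square. The intersection hypothesis, with
    the positive deficits as weights, makes it nonpositive for the new point, so only the bounded
    terms \<open>(d a)\<^sup>2\<close> accumulate.\<close>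
  have "(\<Sum>a\<in>F. max 0 (S a) * d a) =
      (\<Sum>a\<in>F. int (nat (S a))) - q * (\<Sum>a\<in>F. of_bool (y \<in> a) * int (nat (S a)))"
    unfolding d_def sum_distrib_left sum_subtractf[symmetric]
    by (intro sum.cong) (auto simp: algebra_simps max_def)
  then have neg: "(\<Sum>a\<in>F. max 0 (S a) * d a) \<le> 0" using y by simp
  have d: "(d a)\<^sup>2 \<le> q\<^sup>2" for a
    using q by (intro power2_le_iff_abs_le[THEN iffD2]) (auto simp: d_def)
  have step: "(max 0 (S a + d a))\<^sup>2 \<le> (max 0 (S a))\<^sup>2 + 2 * (max 0 (S a) * d a) + q\<^sup>2" for a
  proof -
    have "(max 0 (S a + d a))\<^sup>2 \<le> (max 0 (S a) + d a)\<^sup>2"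
    proof (cases "S a + d a \<le> 0")
      case False
      then show ?thesis by (intro power_mono) (auto simp: max_def)
    qed simp
    also have "\<dots> = (max 0 (S a))\<^sup>2 + 2 * (max 0 (S a) * d a) + (d a)\<^sup>2"
      by (simp add: power2_sum)
    finally show ?thesis using d[of a] by linarith
  qed
  let ?x = "x(T := y)"
  have S': "(\<Sum>t<Suc T. 1 - q * of_bool (?x t \<in> a)) = S a + d a" for a
    by (simp add: S_def d_def)
  have "(\<Sum>a\<in>F. (max 0 (S a + d a))\<^sup>2) \<le>
      (\<Sum>a\<in>F. (max 0 (S a))\<^sup>2 + 2 * (max 0 (S a) * d a) + q\<^sup>2)"
    by (intro sum_mono step)
  also have "\<dots> = (\<Sum>a\<in>F. (max 0 (S a))\<^sup>2) + 2 * (\<Sum>a\<in>F. max 0 (S a) * d a) + q\<^sup>2 * card F"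
    by (simp add: sum.distrib sum_distrib_left)
  also have "\<dots> \<le> q\<^sup>2 * card F * T + q\<^sup>2 * card F" using x neg by (simp add: S_def)
  also have "\<dots> = q\<^sup>2 * card F * Suc T" by (simp add: algebra_simps)
  finally have "(\<Sum>a\<in>F. (max 0 (\<Sum>t<Suc T. 1 - q * of_bool (?x t \<in> a)))\<^sup>2) \<le> q\<^sup>2 * card F * Suc T"
    unfolding S' .
  moreover have "range ?x \<subseteq> X" using x y by auto
  ultimately show ?case by blast
qed

text \<open>The potential bounds the square of a positive deficit by
  \<open>q\<^sup>2 * card F * T\<close>, so at \<open>T = 4 * q\<^sup>2 * card F\<close> no deficit
  exceeds half of \<open>T\<close>. The factor 2 lost here is harmless, as only positivity is wanted
  in the end.\<close>

lemma finite_average_exists: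
  fixes F :: "'a set set"
  assumes F: "finite F" and X: "X \<noteq> {}" and q: "q \<ge> 1"
    and inter: "\<And>w. \<exists>x\<in>X. (\<Sum>a\<in>F. w a) \<le> q * (\<Sum>a\<in>F. of_bool (x \<in> a) * w a :: nat)"
  shows "\<exists>(x :: nat \<Rightarrow> 'a) T. 0 < T \<and> range x \<subseteq> X \<and> (\<forall>a\<in>F. T \<le> 2 * q * card {t. t < T \<and> x t \<in> a})"
proof (cases "F = {}")
  case True
  then show ?thesis using X by (auto intro!: exI[of _ "1::nat"])
next
  case False
  define T where "T = 4 * q\<^sup>2 * card F"
  have T0: "0 < T" using F False q by (simp add: T_def card_gt_0_iff)
  have "\<exists>x\<in>X. (\<Sum>a\<in>F. int (w a)) \<le> int q * (\<Sum>a\<in>F. of_bool (x \<in> a) * int (w a))" for w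
  proof -
    obtain x where "x \<in> X" "(\<Sum>a\<in>F. w a) \<le> q * (\<Sum>a\<in>F. of_bool (x \<in> a) * w a)"
      using inter by blast
    then have "int (\<Sum>a\<in>F. w a) \<le> int (q * (\<Sum>a\<in>F. of_bool (x \<in> a) * w a))"
      by (simp only: of_nat_le_iff)
    then show ?thesis using \<open>x \<in> X\<close> by (auto simp: of_nat_sum simp del: sum_of_bool_mult_eq)
  qed
  from approachability_potential[OF F X _ this, of T] obtain x where x: "range x \<subseteq> X"
    "(\<Sum>a\<in>F. (max 0 (\<Sum>t<T. 1 - int q * of_bool (x t \<in> a)))\<^sup>2) \<le> (int q)\<^sup>2 * card F * T"
    using q by auto
  have "T \<le> 2 * q * card {t. t < T \<and> x t \<in> a}" if a: "a \<in> F" for a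
  proof -
    define S where "S = (\<Sum>t<T. 1 - int q * of_bool (x t \<in> a))"
    have "(max 0 S)\<^sup>2 \<le> (\<Sum>a\<in>F. (max 0 (\<Sum>t<T. 1 - int q * of_bool (x t \<in> a)))\<^sup>2)"
      unfolding S_def using a F by (intro member_le_sum) auto
    then have "4 * (max 0 S)\<^sup>2 \<le> 4 * ((int q)\<^sup>2 * card F * T)" using x by simp
    also have "\<dots> = (int T)\<^sup>2" by (simp add: T_def power2_eq_square)
    finally have "(2 * max 0 S)\<^sup>2 \<le> (int T)\<^sup>2" by (simp add: power_mult_distrib)
    then have "2 * S \<le> int T" using power2_le_imp_le[of "2 * max 0 S" "int T"] by simp
    moreover have "S = int T - int q * card {t. t < T \<and> x t \<in> a}"
      unfolding S_def sum_subtractf sum_distrib_left[symmetric]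
      by (simp add: of_bool_def sum.If_cases lessThan_def Collect_conj_eq)
    ultimately have "int T \<le> int (2 * q * card {t. t < T \<and> x t \<in> a})" by simp
    then show ?thesis by (simp only: of_nat_le_iff)
  qed
  then show ?thesis using T0 x by blast
qed

section \<open>Finitely additive measures by compactness\<close>

definition charge :: "('a set \<Rightarrow> real) \<Rightarrow> bool" where
  "charge \<mu> \<longleftrightarrow> (\<forall>a. 0 \<le> \<mu> a \<and> \<mu> a \<le> 1) \<and> (\<forall>a b. a \<inter> b = {} \<longrightarrow> \<mu> (a \<union> b) = \<mu> a + \<mu> b)"

text \<open>Compactness of a product of unit intervals. Additivity is imposed on all subsets of the
  type, not only on \<open>B\<close>: the visiting frequencies of a finite sequence of points have
  it there, it is a closed condition, and such frequencies meet any finitely many of the lower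
  bounds.\<close>

lemma charge_exists:
  fixes C :: "'a set set"
  assumes avg: "\<And>F. finite F \<Longrightarrow> F \<subseteq> C \<Longrightarrow>
      \<exists>(x :: nat \<Rightarrow> 'a) T. 0 < T \<and> (\<forall>a\<in>F. T \<le> q * card {t. t < T \<and> x t \<in> a})"
  shows "\<exists>\<mu>. charge \<mu> \<and> (\<forall>a\<in>C. 1 \<le> q * \<mu> a)"
proof -
  define Q where "Q = Pi UNIV (\<lambda>_ :: 'a set. {0..1 :: real})"
  define Add where "Add = {\<mu> :: 'a set \<Rightarrow> real. \<forall>a b. a \<inter> b = {} \<longrightarrow> \<mu> (a \<union> b) = \<mu> a + \<mu> b}"
  have [continuous_intros]: "continuous_on UNIV (\<lambda>\<mu> :: 'a set \<Rightarrow> real. \<mu> a)" for a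
    by (rule continuous_on_product_coordinates)
  have "compactin (product_topology (\<lambda>_. euclidean) UNIV) (Pi\<^sub>E UNIV (\<lambda>_ :: 'a set. {0..1 :: real}))"
    by (simp add: compactin_PiE)
  then have "compact Q" by (simp add: Q_def euclidean_product_topology PiE_UNIV_domain)
  moreover have "closed Add"
    unfolding Add_def by (intro closed_Collect_all closed_Collect_imp closed_Collect_eq open_Collect_const continuous_intros)
  ultimately have "compact (Q \<inter> Add)" by (rule compact_Int_closed)
  then have "(Q \<inter> Add) \<inter> (\<Inter>a\<in>C. {\<mu>. 1 \<le> q * \<mu> a}) \<noteq> {}"
  proof (rule compact_imp_fip_image)
    show "closed {\<mu> :: 'a set \<Rightarrow> real. 1 \<le> q * \<mu> a}" for a
      by (intro closed_Collect_le continuous_intros)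
    fix F assume "finite F" "F \<subseteq> C"
    from avg[OF this] obtain x :: "nat \<Rightarrow> 'a" and T where
      xT: "0 < T" "\<And>a. a \<in> F \<Longrightarrow> T \<le> q * card {t. t < T \<and> x t \<in> a}" by blast
    define \<mu> where "\<mu> a = card {t. t < T \<and> x t \<in> a} / real T" for a
    have "card {t. t < T \<and> x t \<in> a} \<le> T" for a
      using card_mono[of "{..<T}" "{t. t < T \<and> x t \<in> a}"] by auto
    then have "\<mu> \<in> Q" using xT by (auto simp: Q_def \<mu>_def)
    moreover have "\<mu> \<in> Add"
    proof -
      have "card {t. t < T \<and> x t \<in> a \<union> b} = card {t. t < T \<and> x t \<in> a} + card {t. t < T \<and> x t \<in> b}"
        if "a \<inter> b = {}" for a b
        using that by (subst card_Un_disjoint[symmetric]) (auto intro!: arg_cong[of _ _ card])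
      then show ?thesis by (simp add: Add_def \<mu>_def add_divide_distrib)
    qed
    moreover have "1 \<le> q * \<mu> a" if "a \<in> F" for a
    proof -
      have "real T \<le> real (q * card {t. t < T \<and> x t \<in> a})" using xT(2)[OF that] by (rule of_nat_mono)
      then show ?thesis using xT(1) by (simp add: \<mu>_def field_simps)
    qed
    ultimately show "(Q \<inter> Add) \<inter> (\<Inter>a\<in>F. {\<mu>. 1 \<le> q * \<mu> a}) \<noteq> {}" by blast
  qed
  then obtain \<mu> where "\<mu> \<in> (Q \<inter> Add) \<inter> (\<Inter>a\<in>C. {\<mu>. 1 \<le> q * \<mu> a})"
    unfolding ex_in_conv[symmetric] by (rule exE)
  then have "\<mu> \<in> Q" "\<mu> \<in> Add" "\<forall>a\<in>C. 1 \<le> q * \<mu> a" by simp_all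
  moreover have "charge \<mu>"
    using \<open>\<mu> \<in> Q\<close> \<open>\<mu> \<in> Add\<close> unfolding charge_def Q_def Add_def by (simp add: Pi_iff)
  ultimately show ?thesis by blast
qed

text \<open>Kelley's criterion. Integer weights become multiplicities: a set \<open>a\<close> of
  weight \<open>w a\<close> is represented by that many pairs with first component \<open>a\<close>,
  which is why the families consist of pairs.\<close>

lemma intersection_number_charge:
  fixes C :: "'a set set"
  assumes X: "X \<noteq> {}" and q: "q \<ge> 1"
    and inter: "\<And>(I :: ('a set \<times> nat) set). finite I \<Longrightarrow> I \<noteq> {} \<Longrightarrow> fst ` I \<subseteq> C \<Longrightarrow>
      \<exists>x\<in>X. card I \<le> q * card {i \<in> I. x \<in> fst i}"
  shows "\<exists>\<mu>. charge \<mu> \<and> (\<forall>a\<in>C. 0 < \<mu> a)"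
proof -
  have "\<exists>(x :: nat \<Rightarrow> 'a) T. 0 < T \<and> (\<forall>a\<in>F. T \<le> (2 * q) * card {t. t < T \<and> x t \<in> a})"
    if F: "finite F" "F \<subseteq> C" for F
  proof -
    have "\<exists>x\<in>X. (\<Sum>a\<in>F. w a) \<le> q * (\<Sum>a\<in>F. of_bool (x \<in> a) * w a)" for w :: "'a set \<Rightarrow> nat"
    proof -
      define I where "I = Sigma F (\<lambda>a. {..<w a})"
      have finI: "finite I" using F by (simp add: I_def)
      have cI: "card I = (\<Sum>a\<in>F. w a)" using F by (simp add: I_def)
      have cx: "card {i \<in> I. x \<in> fst i} = (\<Sum>a\<in>F. of_bool (x \<in> a) * w a)" for x
      proof -
        have "{i \<in> I. x \<in> fst i} = Sigma F (\<lambda>a. if x \<in> a then {..<w a} else {})"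
          by (auto simp: I_def split: if_splits)
        also have "card \<dots> = (\<Sum>a\<in>F. card (if x \<in> a then {..<w a} else {}))"
          using F by (intro card_SigmaI) auto
        also have "\<dots> = (\<Sum>a\<in>F. of_bool (x \<in> a) * w a)" by (intro sum.cong) auto
        finally show ?thesis .
      qed
      show ?thesis
      proof (cases "I = {}")
        case True
        then show ?thesis using X cI by auto
      next
        case False
        have "fst ` I \<subseteq> C" using F by (auto simp: I_def)
        from inter[OF finI False this] show ?thesis unfolding cI cx .
      qed
    qed
    from finite_average_exists[OF F(1) X q this] show ?thesis by blast
  qed
  from charge_exists[OF this] obtain \<mu> where \<mu>: "charge \<mu>" "\<forall>a\<in>C. 1 \<le> real (2 * q) * \<mu> a" by blast
  have "0 < \<mu> a" if "a \<in> C" for a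
    using \<mu>(2) that \<open>charge \<mu>\<close> by (metis charge_def less_eq_real_def mult_zero_right not_one_le_zero)
  then show ?thesis using \<mu>(1) by blast
qed

lemma countable_mixture_charge:
  fixes C :: "nat \<Rightarrow> 'a set set"
  assumes "\<And>n. \<exists>\<mu>. charge \<mu> \<and> (\<forall>a\<in>C n. 0 < \<mu> a)"
  shows "\<exists>\<mu>. charge \<mu> \<and> (\<forall>a\<in>\<Union>n. C n. 0 < \<mu> a)"
proof -
  obtain \<mu> where \<mu>: "\<And>n. charge (\<mu> n)" "\<And>n a. a \<in> C n \<Longrightarrow> 0 < \<mu> n a"
    using assms by metis
  have b: "0 \<le> \<mu> n a" "\<mu> n a \<le> 1" for n a using \<mu>(1) by (auto simp: charge_def)
  define w where "w n = (1 / 2 :: real) ^ Suc n" for n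
  have w: "w sums 1" unfolding w_def by (rule power_half_series)
  have w0: "0 < w n" for n by (simp add: w_def)
  have sm: "summable (\<lambda>n. w n * \<mu> n a)" for a
  proof (rule summable_comparison_test')
    show "summable w" using w by (simp add: sums_iff)
    show "norm (w n * \<mu> n a) \<le> w n" for n
      using b[of n a] w0[of n] by (simp add: abs_mult mult_left_le)
  qed
  define \<nu> where "\<nu> a = (\<Sum>n. w n * \<mu> n a)" for a
  have "charge \<nu>"
    unfolding charge_def
  proof (intro conjI allI impI)
    fix a show "0 \<le> \<nu> a" unfolding \<nu>_def using b w0 by (intro suminf_nonneg sm) (simp add: less_imp_le)
    have "\<nu> a \<le> suminf w"
      unfolding \<nu>_def using b w0 w by (intro suminf_le sm) (auto simp: mult_left_le less_imp_le sums_iff)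
    then show "\<nu> a \<le> 1" using w by (simp add: sums_iff)
  next
    fix a b :: "'a set" assume "a \<inter> b = {}"
    then show "\<nu> (a \<union> b) = \<nu> a + \<nu> b"
      unfolding \<nu>_def using \<mu>(1) by (simp add: charge_def suminf_add[OF sm sm] distrib_left)
  qed
  moreover have "0 < \<nu> a" if "a \<in> C n" for n a
    unfolding \<nu>_def using \<mu>(2)[OF that] w0 b sm
    by (subst suminf_pos_iff) (auto intro!: exI[of _ n] simp: less_imp_le)
  ultimately show ?thesis by blast
qed

subsection \<open>Monotone sequences in Boolean sigma-algebras\<close>

locale boolean_sigma =
  fixes X :: "'a set" and B :: "'a set set"
  assumes bsa: "boolean_sigma_algebra X B"

sublocale boolean_sigma \<subseteq> algebra X B
  using bsa by (simp add: boolean_sigma_algebra_def)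

context boolean_sigma
begin

lemma space_nonempty: "X \<noteq> {}"
  using bsa by (simp add: boolean_sigma_algebra_def)

lemma subset_space: "a \<in> B \<Longrightarrow> a \<subseteq> X"
  using space_closed by blast

lemma bsup_in: "A \<subseteq> B \<Longrightarrow> countable A \<Longrightarrow> bsup B A \<in> B"
  using isLub_bsup[OF bsa] by (rule isLubD1a)

lemma bsup_upper: "A \<subseteq> B \<Longrightarrow> countable A \<Longrightarrow> a \<in> A \<Longrightarrow> a \<subseteq> bsup B A"
  using isLub_bsup[OF bsa] by (rule isLubD2)

lemma bsup_least:
  "A \<subseteq> B \<Longrightarrow> countable A \<Longrightarrow> u \<in> B \<Longrightarrow> (\<And>a. a \<in> A \<Longrightarrow> a \<subseteq> u) \<Longrightarrow> bsup B A \<subseteq> u"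
  by (rule isLub_le_isUb[OF isLub_bsup[OF bsa]]) (auto simp: isUb_def setle_def)

lemma binf_in: "A \<subseteq> B \<Longrightarrow> countable A \<Longrightarrow> binf B A \<in> B"
  using isGlb_binf[OF bsa] by (rule isGlbD1a)

lemma binf_lower: "A \<subseteq> B \<Longrightarrow> countable A \<Longrightarrow> a \<in> A \<Longrightarrow> binf B A \<subseteq> a"
  using isGlb_binf[OF bsa] by (rule isGlbD2)

lemma binf_greatest:
  "A \<subseteq> B \<Longrightarrow> countable A \<Longrightarrow> u \<in> B \<Longrightarrow> (\<And>a. a \<in> A \<Longrightarrow> u \<subseteq> a) \<Longrightarrow> u \<subseteq> binf B A"
  by (rule isGlb_le_isLb[OF isGlb_binf[OF bsa]]) (auto simp: isLb_def setge_def)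

text \<open>A sequence decreasing to zero in the order of \<open>B\<close>. Its terms may have
  points in common; only lower bounds that belong to \<open>B\<close> are required to
  vanish.\<close>

definition null_seq :: "(nat \<Rightarrow> 'a set) \<Rightarrow> bool" where
  "null_seq d \<longleftrightarrow> range d \<subseteq> B \<and> decseq d \<and> (\<forall>l\<in>B. (\<forall>n. l \<subseteq> d n) \<longrightarrow> l = {})"

definition conv_zero :: "(nat \<Rightarrow> 'a set) \<Rightarrow> bool" where
  "conv_zero a \<longleftrightarrow> (\<exists>d. null_seq d \<and> (\<forall>n. a n \<subseteq> d n))"

definition increases_to :: "(nat \<Rightarrow> 'a set) \<Rightarrow> 'a set \<Rightarrow> bool" where
  "increases_to c a \<longleftrightarrow> range c \<subseteq> B \<and> a \<in> B \<and> incseq c \<and> (\<forall>k. c k \<subseteq> a) \<and>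
    (\<forall>u\<in>B. (\<forall>k. c k \<subseteq> u) \<longrightarrow> a \<subseteq> u)"

lemma null_seqD:
  assumes "null_seq d"
  shows "d n \<in> B" "m \<le> n \<Longrightarrow> d n \<subseteq> d m" "l \<in> B \<Longrightarrow> (\<And>n. l \<subseteq> d n) \<Longrightarrow> l = {}"
  using assms by (auto simp: null_seq_def decseq_def)

lemma increases_toD:
  assumes "increases_to c a"
  shows "c k \<in> B" "a \<in> B" "i \<le> j \<Longrightarrow> c i \<subseteq> c j" "c k \<subseteq> a"
    "u \<in> B \<Longrightarrow> (\<And>k. c k \<subseteq> u) \<Longrightarrow> a \<subseteq> u"
  using assms by (simp_all add: increases_to_def incseq_def image_subset_iff)

lemma increases_to_const: "a \<in> B \<Longrightarrow> increases_to (\<lambda>_. a) a"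
  by (auto simp: increases_to_def incseq_def)

lemma null_seq_eventually_lower:
  assumes d: "null_seq d" and l: "l \<in> B" "\<And>n. m \<le> n \<Longrightarrow> l \<subseteq> d n"
  shows "l = {}"
proof (rule null_seqD(3)[OF d l(1)])
  fix n
  have "l \<subseteq> d (max m n)" by (rule l) simp
  also have "\<dots> \<subseteq> d n" by (rule null_seqD(2)[OF d]) simp
  finally show "l \<subseteq> d n" .
qed

text \<open>The suprema of the tails form the least decreasing sequence in \<open>B\<close> above
  \<open>a\<close>, so they are a dominating null sequence as soon as there is any. Domination is
  the handier form because it involves no suprema.\<close>

lemma blim_zero_iff:
  assumes a: "\<And>n. a n \<in> B"
  shows "blim B a {} \<longleftrightarrow> conv_zero a"
proof
  have tail: "a ` {n..} \<subseteq> B" "countable (a ` {n..})" for n using a by auto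
  define D where "D n = bsup B (a ` {n..})" for n
  have DB: "D n \<in> B" for n unfolding D_def using tail by (rule bsup_in)
  have ranD: "range D \<subseteq> B" "countable (range D)" using DB by auto
  have upper: "a k \<subseteq> D n" if "n \<le> k" for n k
    unfolding D_def using tail by (rule bsup_upper) (use that in simp)
  have limsup: "blimsup B a = binf B (range D)" by (simp add: blimsup_def D_def)
  show "conv_zero a" if "blim B a {}"
    unfolding conv_zero_def
  proof (intro exI conjI allI)
    show "a n \<subseteq> D n" for n by (rule upper) simp
    show "null_seq D"
      unfolding null_seq_def
    proof (intro conjI ballI impI ranD)
      show "decseq D"
        unfolding decseq_def
      proof (intro allI impI)
        fix m n :: nat assume "m \<le> n"
        then show "D n \<subseteq> D m"
          unfolding D_def[of n] using upper
          by (intro bsup_least[OF tail DB]) (metis atLeast_iff imageE le_trans)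
      qed
      fix l assume "l \<in> B" "\<forall>n. l \<subseteq> D n"
      then have "l \<subseteq> binf B (range D)" using ranD by (intro binf_greatest) auto
      then show "l = {}" using that limsup by (simp add: blim_def)
    qed
  qed
  show "blim B a {}" if conv: "conv_zero a"
  proof -
    from conv obtain d where d: "null_seq d" "\<And>n. a n \<subseteq> d n" by (auto simp: conv_zero_def)
    have le: "a n \<subseteq> d m" if "m \<le> n" for m n
      using d(2)[of n] null_seqD(2)[OF d(1) that] by blast
    have "blimsup B a = {}"
      unfolding limsup
    proof (rule null_seqD(3)[OF d(1)])
      show "binf B (range D) \<in> B" using ranD by (rule binf_in)
      fix n
      have "binf B (range D) \<subseteq> D n" using ranD by (rule binf_lower) simp
      also have "D n \<subseteq> d n"
        unfolding D_def using tail null_seqD(1)[OF d(1)] by (rule bsup_least) (auto dest: le[THEN subsetD])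
      finally show "binf B (range D) \<subseteq> d n" .
    qed
    moreover have "binf B (a ` {n..}) = {}" for n
    proof (rule null_seq_eventually_lower[OF d(1)])
      show "binf B (a ` {n..}) \<in> B" using tail by (rule binf_in)
      show "binf B (a ` {n..}) \<subseteq> d m" if "n \<le> m" for m
      proof -
        have "binf B (a ` {n..}) \<subseteq> a m" using tail by (rule binf_lower) (use that in simp)
        then show ?thesis using d(2) by blast
      qed
    qed
    then have "bliminf B a = bsup B {{}}" by (simp add: bliminf_def)
    moreover have "bsup B {{}} \<subseteq> {}" by (rule bsup_least) auto
    ultimately show ?thesis by (simp add: blim_def)
  qed
qed

section \<open>Order limits under unions, differences and intersections\<close>

lemma null_seq_Un:
  assumes d: "null_seq d" "null_seq d'"
  shows "null_seq (\<lambda>n. d n \<union> d' n)"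
  unfolding null_seq_def
proof (intro conjI ballI impI)
  show "range (\<lambda>n. d n \<union> d' n) \<subseteq> B" using d by (auto dest: null_seqD(1))
  show "decseq (\<lambda>n. d n \<union> d' n)"
    unfolding decseq_def using null_seqD(2)[OF d(1)] null_seqD(2)[OF d(2)] by blast
  fix l assume l: "l \<in> B" "\<forall>n. l \<subseteq> d n \<union> d' n"
  have "l \<subseteq> d' m" for m
  proof -
    \<comment> \<open>For fixed \<open>m\<close>, what \<open>d' m\<close> leaves of
      \<open>l\<close> lies in \<open>d n\<close> for all \<open>n \<ge> m\<close>, because
      \<open>d' n\<close> is then inside \<open>d' m\<close>.\<close>
    have "l - d' m = {}"
    proof (rule null_seq_eventually_lower[OF d(1)])
      show "l - d' m \<in> B" using l d(2) by (auto dest: null_seqD(1))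
      show "l - d' m \<subseteq> d n" if "m \<le> n" for n
        using l(2) null_seqD(2)[OF d(2) that] by blast
    qed
    then show ?thesis by blast
  qed
  then show "l = {}" using null_seqD(3)[OF d(2) l(1)] by blast
qed

lemma conv_zero_Un: "conv_zero a \<Longrightarrow> conv_zero b \<Longrightarrow> conv_zero (\<lambda>n. a n \<union> b n)"
  unfolding conv_zero_def using null_seq_Un by (meson Un_mono)

lemma conv_zero_mono: "conv_zero b \<Longrightarrow> (\<And>n. a n \<subseteq> b n) \<Longrightarrow> conv_zero a"
  unfolding conv_zero_def by (meson subset_trans)

lemma increases_to_imp_null_seq:
  assumes c: "increases_to c a"
  shows "null_seq (\<lambda>k. a - c k)"
  unfolding null_seq_def
proof (intro conjI ballI impI)
  show "range (\<lambda>k. a - c k) \<subseteq> B" using c by (auto dest: increases_toD)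
  show "decseq (\<lambda>k. a - c k)"
    unfolding decseq_def using increases_toD(3)[OF c] by blast
  fix l assume l: "l \<in> B" "\<forall>k. l \<subseteq> a - c k"
  have "a \<subseteq> X - l"
  proof (rule increases_toD(5)[OF c])
    show "X - l \<in> B" using l compl_sets by blast
    show "c k \<subseteq> X - l" for k
      using l subset_space[OF increases_toD(1)[OF c, of k]] by blast
  qed
  then show "l = {}" using l by blast
qed

lemma null_seq_imp_increases_to:
  assumes d: "null_seq d"
  shows "increases_to (\<lambda>k. d m - d k) (d m)"
  unfolding increases_to_def
proof (intro conjI ballI impI allI)
  show "range (\<lambda>k. d m - d k) \<subseteq> B" "d m \<in> B" using d by (auto dest: null_seqD(1))
  show "incseq (\<lambda>k. d m - d k)"
    unfolding incseq_def using null_seqD(2)[OF d] by blast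
  fix u assume u: "u \<in> B" "\<forall>k. d m - d k \<subseteq> u"
  have "d m - u = {}"
    by (rule null_seqD(3)[OF d]) (use u null_seqD(1)[OF d] in auto)
  then show "d m \<subseteq> u" by blast
qed blast

lemma increases_to_Int:
  assumes c: "increases_to c a" and b: "b \<in> B"
  shows "increases_to (\<lambda>k. c k \<inter> b) (a \<inter> b)"
  unfolding increases_to_def
proof (intro conjI ballI impI allI)
  show "range (\<lambda>k. c k \<inter> b) \<subseteq> B" "a \<inter> b \<in> B" using c b by (auto dest: increases_toD)
  show "incseq (\<lambda>k. c k \<inter> b)"
    unfolding incseq_def using increases_toD(3)[OF c] by blast
  show "c k \<inter> b \<subseteq> a \<inter> b" for k using increases_toD(4)[OF c] by blast
  fix u assume u: "u \<in> B" "\<forall>k. c k \<inter> b \<subseteq> u"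
  \<comment> \<open>This is the largest element of \<open>B\<close> whose intersection with
    \<open>b\<close> lies in \<open>u\<close>, so a bound of the \<open>c k \<inter> b\<close> turns
    into a bound of the \<open>c k\<close>.\<close>
  have "a \<subseteq> u \<union> (X - b)"
  proof (rule increases_toD(5)[OF c])
    show "u \<union> (X - b) \<in> B" using u b compl_sets by blast
    show "c k \<subseteq> u \<union> (X - b)" for k
      using u subset_space[OF increases_toD(1)[OF c, of k]] by blast
  qed
  then show "a \<inter> b \<subseteq> u" by blast
qed

section \<open>Layers of null sequences and diagonal choices\<close>

lemma null_seq_layers_disjoint:
  assumes d: "null_seq d" and "i \<noteq> j"
  shows "(d i - d (Suc i)) \<inter> (d j - d (Suc j)) = {}"
proof -
  have "(d i - d (Suc i)) \<inter> (d j - d (Suc j)) = {}" if "i < j" for i j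
    using null_seqD(2)[OF d, of "Suc i" j] that by auto
  from this[of i j] this[of j i] show ?thesis
    using assms(2) by (cases "i < j") auto
qed

text \<open>The bridge from sequences to partitions: meeting only finitely many layers means being
  disjoint from a late term of the sequence. Empty layers are dropped since antichains consist of
  nonempty elements.\<close>

lemma null_seq_unit_partition:
  assumes d: "null_seq d"
  shows "unit_partition B (insert (X - d 0) (range (\<lambda>k. d k - d (Suc k))) - {{}})"
    (is "unit_partition B ?W")
proof -
  have dB: "d n \<in> B" for n using null_seqD(1)[OF d] .
  have d0: "d i \<subseteq> d 0" for i using null_seqD(2)[OF d] by simp
  have "antichain B ?W"
    unfolding antichain_def
  proof (intro conjI ballI impI)
    show "?W \<subseteq> positive_part B" using dB compl_sets by (auto simp: positive_part_def)
    fix a b assume "a \<in> ?W" "b \<in> ?W" "a \<noteq> b"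
    then consider "a = X - d 0" "\<exists>j. b = d j - d (Suc j)"
      | "b = X - d 0" "\<exists>j. a = d j - d (Suc j)"
      | i j where "a = d i - d (Suc i)" "b = d j - d (Suc j)" "i \<noteq> j" by blast
    then show "a \<inter> b = {}" using d0 null_seq_layers_disjoint[OF d] by cases blast+
  qed
  moreover have "isLub B ?W X"
  proof (rule isLubI2)
    show "isUb B ?W X" using dB subset_space by (auto simp: isUb_def setle_def)
    have "X \<subseteq> u" if u: "u \<in> B" "\<forall>w\<in>?W. w \<subseteq> u" for u
    proof -
      have w: "w \<subseteq> u" if "w \<in> insert (X - d 0) (range (\<lambda>k. d k - d (Suc k)))" for w
        using u(2) that by (cases "w = {}") auto
      \<comment> \<open>Each layer lies in \<open>u\<close>, so the part outside \<open>u\<close> is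
        pushed from \<open>d n\<close> down to \<open>d (Suc n)\<close>.\<close>
      have "X - u \<subseteq> d n" for n
      proof (induction n)
        case 0
        then show ?case using w[of "X - d 0"] by blast
      next
        case (Suc n)
        then show ?case using w[of "d n - d (Suc n)"] by blast
      qed
      then have "X - u = {}" using null_seqD(3)[OF d] u(1) compl_sets by blast
      then show ?thesis by blast
    qed
    then show "X <=* Collect (isUb B ?W)" by (auto simp: setge_def isUb_def setle_def)
  qed
  ultimately show ?thesis using unit_partition_iff_isLub[OF algebra_axioms] by blast
qed

lemma unit_partition_disjoint:
  assumes W: "unit_partition B W" and l: "l \<in> B" "\<And>w. w \<in> W \<Longrightarrow> l \<inter> w = {}"
  shows "l = {}"
proof -
  have L: "isLub B W X" and "W \<subseteq> B"
    using W unit_partition_iff_isLub[OF algebra_axioms]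
    by (auto simp: antichain_def positive_part_def)
  have "isUb B W (X - l)"
    unfolding isUb_def setle_def
    using l compl_sets \<open>W \<subseteq> B\<close> subset_space by blast
  with L have "X \<subseteq> X - l" by (rule isLub_le_isUb)
  then show ?thesis using subset_space[OF l(1)] by blast
qed

text \<open>Each member of the partition \<open>V\<close> obtained from the layers is disjoint from
  a late term of every \<open>e n\<close>. Since \<open>V\<close> can be enumerated,
  \<open>f n\<close> can be taken so late that \<open>e n (f n)\<close> misses the first
  \<open>n + 1\<close> members. The tails then miss more and more of \<open>V\<close>, and an
  element disjoint from all of \<open>V\<close> is zero.\<close>

lemma weakly_distributive_diagonal:
  fixes e :: "nat \<Rightarrow> nat \<Rightarrow> 'a set"
  assumes wd: "weakly_distributive B" and ccc: "\<And>A. antichain B A \<Longrightarrow> countable A"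
    and e: "\<And>n. null_seq (e n)"
  shows "\<exists>f. conv_zero (\<lambda>n. e n (f n))"
proof -
  define W where "W n = insert (X - e n 0) (range (\<lambda>k. e n k - e n (Suc k))) - {{}}" for n
  have "\<forall>n. unit_partition B (W n)" unfolding W_def using null_seq_unit_partition[OF e] by blast
  with wd[unfolded weakly_distributive_def, rule_format, of W]
  obtain V where V: "unit_partition B V" "\<And>v n. v \<in> V \<Longrightarrow> finite {w \<in> W n. v \<inter> w \<noteq> {}}"
    by metis
  have VB: "V \<subseteq> B" and cV: "countable V"
    using V(1) ccc by (auto simp: unit_partition_def antichain_def positive_part_def)
  have "V \<noteq> {}" using unit_partition_disjoint[OF V(1), of X] space_nonempty by auto
  have ex: "\<exists>k. v \<inter> e n k = {}" if v: "v \<in> V" for v n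
  proof -
    have dB: "e n k \<in> B" for k using null_seqD(1)[OF e] .
    \<comment> \<open>Layers with index in \<open>J\<close> are nonempty and disjoint, hence
      distinct members of \<open>W n\<close>; finiteness of the set of members therefore bounds the
      indices.\<close>
    define J where "J = {j. v \<inter> (e n j - e n (Suc j)) \<noteq> {}}"
    have "inj_on (\<lambda>j. e n j - e n (Suc j)) J"
    proof (rule inj_onI, rule ccontr)
      fix i j assume *: "i \<in> J" "j \<in> J" "e n i - e n (Suc i) = e n j - e n (Suc j)" "i \<noteq> j"
      have "e n i - e n (Suc i) = {}" using * null_seq_layers_disjoint[OF e, of i j n] by simp
      then have "v \<inter> (e n i - e n (Suc i)) = {}" by (simp only: Int_empty_right)
      then show False using *(1) by (simp only: J_def mem_Collect_eq)
    qed
    moreover have "(\<lambda>j. e n j - e n (Suc j)) ` J \<subseteq> {w \<in> W n. v \<inter> w \<noteq> {}}"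
      by (auto simp: J_def W_def)
    ultimately have "finite J"
      using finite_imageD[of "\<lambda>j. e n j - e n (Suc j)" J] finite_subset V(2)[OF v, of n] by blast
    then obtain k where k: "\<And>j. j \<in> J \<Longrightarrow> j < k" by (meson finite_nat_set_iff_bounded)
    have "v \<inter> e n k = {}"
    proof (rule null_seq_eventually_lower[OF e])
      show "v \<inter> e n k \<in> B" using v VB dB by blast
      show "v \<inter> e n k \<subseteq> e n j" if "k \<le> j" for j
        using that
      proof (induction j rule: dec_induct)
        case (step j)
        then have "j \<notin> J" using k by fastforce
        then have "v \<inter> (e n j - e n (Suc j)) = {}" by (simp add: J_def)
        then show ?case using step by blast
      qed simp
    qed
    then show ?thesis by blast
  qed
  define v where "v = from_nat_into V"
  have v: "v i \<in> V" for i unfolding v_def using \<open>V \<noteq> {}\<close> by (rule from_nat_into)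
  have "\<exists>k. \<forall>i\<le>n. v i \<inter> e n k = {}" for n
  proof -
    have "\<forall>i. \<exists>k. v i \<inter> e n k = {}" using ex v by blast
    then obtain h where h: "\<And>i. v i \<inter> e n (h i) = {}" by metis
    have "v i \<inter> e n (Max (h ` {..n})) = {}" if "i \<le> n" for i
    proof -
      have "h i \<le> Max (h ` {..n})" using that by simp
      then show ?thesis using null_seqD(2)[OF e] h[of i] by blast
    qed
    then show ?thesis by blast
  qed
  then obtain f where f: "\<And>n i. i \<le> n \<Longrightarrow> v i \<inter> e n (f n) = {}" by metis
  have eB: "e n (f n) \<in> B" for n using null_seqD(1)[OF e] .
  define D where "D n = bsup B ((\<lambda>n. e n (f n)) ` {n..})" for n
  have tail: "(\<lambda>n. e n (f n)) ` {n..} \<subseteq> B" "countable ((\<lambda>n. e n (f n)) ` {n..})" for n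
    using eB by auto
  have up: "e k (f k) \<subseteq> D n" if "n \<le> k" for n k
    unfolding D_def using tail by (rule bsup_upper) (use that in simp)
  have DB: "D n \<in> B" for n unfolding D_def using tail by (rule bsup_in)
  have "null_seq D"
    unfolding null_seq_def
  proof (intro conjI ballI impI)
    show "decseq D"
      unfolding decseq_def
    proof (intro allI impI)
      fix m n :: nat assume "m \<le> n"
      then show "D n \<subseteq> D m"
        unfolding D_def[of n]
      proof (intro bsup_least[OF tail DB])
        fix a assume "a \<in> (\<lambda>n. e n (f n)) ` {n..}"
        then obtain k where "a = e k (f k)" "n \<le> k" by auto
        then show "a \<subseteq> D m" using up[of m k] \<open>m \<le> n\<close> by simp
      qed
    qed
    fix l assume l: "l \<in> B" "\<forall>n. l \<subseteq> D n"
    show "l = {}"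
    proof (rule unit_partition_disjoint[OF V(1) l(1)])
      fix w assume "w \<in> V"
      then obtain i where i: "w = v i" unfolding v_def using from_nat_into_surj[OF cV] by metis
      \<comment> \<open>From index \<open>i\<close> on, every \<open>e n (f n)\<close> has been
        chosen disjoint from \<open>v i\<close>.\<close>
      have "D i \<subseteq> X - v i"
        unfolding D_def
      proof (rule bsup_least[OF tail])
        show "X - v i \<in> B" using v VB compl_sets by blast
        fix a assume "a \<in> (\<lambda>n. e n (f n)) ` {i..}"
        then show "a \<subseteq> X - v i" using f subset_space[OF eB] by blast
      qed
      then show "l \<inter> w = {}" using l i by blast
    qed
  qed (use DB in auto)
  then show ?thesis unfolding conv_zero_def using up by blast
qed

end

subsection \<open>Regular fragmentations\<close>

lemma bounded_antichains_imp_countable: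
  fixes C :: "nat \<Rightarrow> 'a set set"
  assumes bound: "\<And>n. \<exists>K :: nat. \<forall>A. antichain B A \<and> A \<subseteq> C n \<longrightarrow> finite A \<and> card A \<le> K"
    and cover: "positive_part B \<subseteq> (\<Union>n. C n)" and A: "antichain B A"
  shows "countable A"
proof -
  have "finite (A \<inter> C n)" for n
  proof -
    have "antichain B (A \<inter> C n)" using A by (auto simp: antichain_def)
    then show ?thesis using bound[of n] by blast
  qed
  then have "countable (\<Union>n. A \<inter> C n)"
    by (intro countable_UN countableI_type countable_finite)
  moreover have "A = (\<Union>n. A \<inter> C n)" using A cover by (auto simp: antichain_def)
  ultimately show ?thesis by simp
qed

context boolean_sigma
begin

text \<open>The upward closure of the increasing unions of the given families keeps both hypotheses;
  passing on to those \<open>a\<close> that cannot be approached from below by elements outside yields sets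
  whose complements are neighbourhoods of zero for sequential convergence.\<close>

lemma regular_fragmentation:
  fixes C :: "nat \<Rightarrow> 'a set set"
  assumes wd: "weakly_distributive B"
    and C: "\<And>n. C n \<subseteq> positive_part B" "positive_part B = (\<Union>n. C n)"
    and bound: "\<And>n. \<exists>K :: nat. \<forall>A. antichain B A \<and> A \<subseteq> C n \<longrightarrow> finite A \<and> card A \<le> K"
    and conv: "\<And>a. (\<And>n. a n \<in> B) \<Longrightarrow> (\<And>n. a n \<notin> C n) \<Longrightarrow> conv_zero a"
  obtains E :: "nat \<Rightarrow> 'a set set" where
    "\<And>n. E n \<subseteq> positive_part B" "positive_part B \<subseteq> (\<Union>n. E n)"
    "\<And>n. \<exists>K :: nat. \<forall>A. antichain B A \<and> A \<subseteq> E n \<longrightarrow> finite A \<and> card A \<le> K"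
    "\<And>n. \<exists>n'. \<forall>c1\<in>B. \<forall>c2\<in>B. \<forall>c3\<in>B. c1 \<union> c2 \<union> c3 \<in> E n \<longrightarrow>
      c1 \<in> E n' \<or> c2 \<in> E n' \<or> c3 \<in> E n'"
proof -
  have ccc: "countable A" if "antichain B A" for A
    using bounded_antichains_imp_countable[of B C A] bound C(2) that by blast
  define U where "U n = {a \<in> B. \<exists>i\<le>n. \<exists>b\<in>C i. b \<subseteq> a}" for n
  define E where "E n = {a \<in> B. \<forall>c. increases_to c a \<longrightarrow> (\<exists>k. c k \<in> U n)}" for n
  have Upos: "{} \<notin> U n" for n using C(1) by (fastforce simp: U_def positive_part_def)
  have Uup: "b \<in> U n" if "a \<in> U n" "a \<subseteq> b" "b \<in> B" for a b n
    using that unfolding U_def by blast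
  have EU: "E n \<subseteq> U n" for n using increases_to_const unfolding E_def by fastforce
  have EB: "E n \<subseteq> B" for n by (auto simp: E_def)
  have CU: "C n \<subseteq> U n" for n using C(1) by (auto simp: U_def positive_part_def)
  have Eup: "b \<in> E n" if a: "a \<in> E n" and ab: "a \<subseteq> b" and b: "b \<in> B" for a b n
  proof -
    have "\<exists>k. c k \<in> U n" if c: "increases_to c b" for c
    proof -
      have "a \<in> B" using a EB by blast
      then have "increases_to (\<lambda>k. c k \<inter> a) a"
        using increases_to_Int[OF c, of a] ab by (simp add: Int_absorb1)
      then obtain k where "c k \<inter> a \<in> U n" using a by (auto simp: E_def)
      then have "c k \<in> U n" by (rule Uup) (use increases_toD(1)[OF c] in auto)
      then show ?thesis by blast
    qed
    then show ?thesis using b by (simp add: E_def)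
  qed
  have Ubound: "\<exists>K :: nat. \<forall>A. antichain B A \<and> A \<subseteq> U n \<longrightarrow> finite A \<and> card A \<le> K" for n
  proof -
    obtain K :: "nat \<Rightarrow> nat" where
      K: "\<And>n A. antichain B A \<Longrightarrow> A \<subseteq> C n \<Longrightarrow> finite A \<and> card A \<le> K n"
      using bound by metis
    have "finite A \<and> card A \<le> (\<Sum>i\<le>n. K i)" if A: "antichain B A" "A \<subseteq> U n" for A
    proof -
      \<comment> \<open>Shrinking each member to an element of some \<open>C i\<close> keeps the
        members disjoint and nonempty, hence distinct, and distributes them over
        \<open>n + 1\<close> antichains of bounded size.\<close>
      have "\<exists>b. (\<exists>i\<le>n. b \<in> C i) \<and> b \<subseteq> a" if "a \<in> A" for a
        using A(2) that unfolding U_def by blast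
      then obtain \<phi> where \<phi>: "\<And>a. a \<in> A \<Longrightarrow> (\<exists>i\<le>n. \<phi> a \<in> C i) \<and> \<phi> a \<subseteq> a" by metis
      have pos: "\<phi> a \<in> B" "\<phi> a \<noteq> {}" if "a \<in> A" for a
        using \<phi>[OF that] C(1) by (auto simp: positive_part_def)
      have disj: "\<phi> a \<inter> \<phi> b = {}" if ab: "a \<in> A" "b \<in> A" "a \<noteq> b" for a b
      proof -
        have "a \<inter> b = {}" using A(1) ab by (simp add: antichain_def)
        then show ?thesis using \<phi>[OF ab(1)] \<phi>[OF ab(2)] by blast
      qed
      have inj: "inj_on \<phi> A"
      proof (rule inj_onI, rule ccontr)
        fix a b assume *: "a \<in> A" "b \<in> A" "\<phi> a = \<phi> b" "a \<noteq> b"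
        then have "\<phi> a = {}" using disj[of a b] by simp
        then show False using pos(2) * by blast
      qed
      have anti: "antichain B (\<phi> ` A \<inter> C i)" for i
        unfolding antichain_def using C(1) disj by blast
      have "\<phi> ` A = (\<Union>i\<in>{..n}. \<phi> ` A \<inter> C i)" using \<phi> by fastforce
      moreover have "finite (\<Union>i\<in>{..n}. \<phi> ` A \<inter> C i)"
        by (intro finite_UN_I) (use K[OF anti] in auto)
      moreover have "card (\<Union>i\<in>{..n}. \<phi> ` A \<inter> C i) \<le> (\<Sum>i\<le>n. card (\<phi> ` A \<inter> C i))"
        by (rule card_UN_le) simp
      moreover have "\<dots> \<le> (\<Sum>i\<le>n. K i)" by (intro sum_mono) (use K[OF anti] in auto)
      ultimately have "finite (\<phi> ` A)" "card (\<phi> ` A) \<le> (\<Sum>i\<le>n. K i)" by simp_all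
      then show ?thesis using inj by (simp add: card_image finite_image_iff)
    qed
    then show ?thesis by blast
  qed
  \<comment> \<open>Every \<open>a n\<close> is a limit from below of elements outside
    \<open>U n\<close>. The diagonal lemma selects one of them for each \<open>n\<close> so that the
    differences converge to zero; the selected elements avoid \<open>C n\<close> and converge to
    zero by hypothesis.\<close>
  have Econv: "conv_zero a" if a: "\<And>n. a n \<in> B" "\<And>n. a n \<notin> E n" for a
  proof -
    have "\<exists>c. increases_to c (a n) \<and> (\<forall>k. c k \<notin> U n)" for n
      using a(1)[of n] a(2)[of n] by (auto simp: E_def)
    then obtain c where c: "\<And>n. increases_to (c n) (a n)" "\<And>n k. c n k \<notin> U n" by metis
    obtain f where f: "conv_zero (\<lambda>n. a n - c n (f n))"
      using weakly_distributive_diagonal[OF wd ccc, of "\<lambda>n k. a n - c n k"]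
        increases_to_imp_null_seq[OF c(1)] by auto
    have "conv_zero (\<lambda>n. c n (f n))"
    proof (rule conv)
      show "c n (f n) \<in> B" for n using increases_toD(1)[OF c(1)] .
      show "c n (f n) \<notin> C n" for n using c(2) CU by blast
    qed
    from conv_zero_Un[OF f this] show ?thesis by (rule conv_zero_mono) blast
  qed
  \<comment> \<open>As \<open>d m - d k\<close> increases to \<open>d m\<close>, membership of
    \<open>d m\<close> in \<open>E n\<close> puts some such difference in \<open>U n\<close>. If
    this held for all \<open>m\<close>, iterating \<open>s\<close> from 0 would give infinitely many
    disjoint layers in \<open>U n\<close>.\<close>
  have Enull: "\<exists>m. d m \<notin> E n" if d: "null_seq d" for d n
  proof (rule ccontr)
    assume "\<not> ?thesis"
    then have dE: "d m \<in> E n" for m by blast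
    have "\<exists>k. d m - d k \<in> U n" for m
      using dE[of m] null_seq_imp_increases_to[OF d, of m] by (auto simp: E_def)
    then obtain s where s: "\<And>m. d m - d (s m) \<in> U n" by metis
    have sm: "m < s m" for m
    proof (rule ccontr)
      assume "\<not> m < s m"
      then have "d m - d (s m) = {}" using null_seqD(2)[OF d, of "s m" m] by auto
      then show False using s[of m] Upos[of n] by metis
    qed
    define t where "t i = (s ^^ i) 0" for i
    have t: "t (Suc i) = s (t i)" for i by (simp add: t_def)
    have "strict_mono t" using sm by (simp add: strict_mono_Suc_iff t)
    have "null_seq (d \<circ> t)"
      unfolding null_seq_def
    proof (intro conjI ballI impI)
      show "range (d \<circ> t) \<subseteq> B" using null_seqD(1)[OF d] by auto
      show "decseq (d \<circ> t)"
        unfolding decseq_def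
        using null_seqD(2)[OF d] strict_mono_leD[OF \<open>strict_mono t\<close>] by simp
      fix l assume l: "l \<in> B" "\<forall>n. l \<subseteq> (d \<circ> t) n"
      have "l \<subseteq> d m" for m
      proof -
        have "m \<le> t m" using \<open>strict_mono t\<close> by (rule strict_mono_imp_increasing)
        then show ?thesis using l(2) null_seqD(2)[OF d] by fastforce
      qed
      then show "l = {}" using null_seqD(3)[OF d l(1)] by blast
    qed
    note layers = null_seq_layers_disjoint[OF this, simplified]
    define L where "L i = d (t i) - d (t (Suc i))" for i
    have LU: "L i \<in> U n" for i using s by (simp add: L_def t)
    have disj: "L i \<inter> L j = {}" if "i \<noteq> j" for i j
      using layers[OF that] by (simp add: L_def)
    have "inj L"
    proof (rule injI, rule ccontr)
      fix i j assume "L i = L j" "i \<noteq> j"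
      then have "L i = {}" using disj[of i j] by simp
      then show False using LU[of i] Upos by simp
    qed
    then have "infinite (range L)" by (rule range_inj_infinite)
    moreover have "antichain B (range L)"
    proof -
      have "L i \<in> positive_part B" for i
        using LU[of i] Upos[of n] by (auto simp: U_def positive_part_def)
      then show ?thesis unfolding antichain_def using disj by (metis imageE image_subsetI)
    qed
    moreover have "range L \<subseteq> U n" using LU by blast
    ultimately show False using Ubound[of n] by blast
  qed
  \<comment> \<open>If every \<open>m\<close> had a counterexample, its pieces would avoid
    \<open>E m\<close> and so converge to zero, as would their unions. The dominating null sequence
    would then stay in the upward closed \<open>E n\<close>, against \<open>Enull\<close>.\<close>
  have split: "\<exists>n'. \<forall>c1\<in>B. \<forall>c2\<in>B. \<forall>c3\<in>B. c1 \<union> c2 \<union> c3 \<in> E n \<longrightarrow> c1 \<in> E n' \<or> c2 \<in> E n' \<or> c3 \<in> E n'"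
    for n
  proof (rule ccontr)
    assume no: "\<not> ?thesis"
    define Q where "Q m c1 c2 c3 \<longleftrightarrow> c1 \<in> B \<and> c2 \<in> B \<and> c3 \<in> B \<and> c1 \<union> c2 \<union> c3 \<in> E n \<and>
        c1 \<notin> E m \<and> c2 \<notin> E m \<and> c3 \<notin> E m" for m c1 c2 c3
    have "\<exists>c1 c2 c3. Q m c1 c2 c3" for m
      using no unfolding Q_def by meson
    then obtain c1 c2 c3 where "\<And>m. Q m (c1 m) (c2 m) (c3 m)" by metis
    then have c: "c1 m \<in> B" "c2 m \<in> B" "c3 m \<in> B" "c1 m \<union> c2 m \<union> c3 m \<in> E n"
      "c1 m \<notin> E m" "c2 m \<notin> E m" "c3 m \<notin> E m" for m
      by (simp_all add: Q_def)
    have "conv_zero c1" "conv_zero c2" "conv_zero c3" using c by (auto intro: Econv)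
    then have "conv_zero (\<lambda>m. c1 m \<union> c2 m \<union> c3 m)" by (intro conv_zero_Un)
    then obtain d where d: "null_seq d" "\<And>m. c1 m \<union> c2 m \<union> c3 m \<subseteq> d m"
      by (auto simp: conv_zero_def)
    obtain m where "d m \<notin> E n" using Enull[OF d(1)] by blast
    moreover have "d m \<in> E n" using c(4) d(2) null_seqD(1)[OF d(1)] by (rule Eup)
    ultimately show False by blast
  qed
  have cover: "positive_part B \<subseteq> (\<Union>n. E n)"
  proof (rule ccontr)
    assume "\<not> ?thesis"
    then obtain a where a: "a \<in> B" "a \<noteq> {}" "\<And>n. a \<notin> E n" by (auto simp: positive_part_def)
    \<comment> \<open>An element in none of the \<open>E n\<close> yields a constant sequence to
      which \<open>Econv\<close> applies.\<close>
    then have "conv_zero (\<lambda>_. a)" by (intro Econv)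
    then obtain d where "null_seq d" "\<And>n. a \<subseteq> d n" by (auto simp: conv_zero_def)
    then show False using null_seqD(3) a by blast
  qed
  have "\<exists>K :: nat. \<forall>A. antichain B A \<and> A \<subseteq> E n \<longrightarrow> finite A \<and> card A \<le> K" for n
    using Ubound[of n] EU[of n] by (meson subset_trans)
  moreover have "E n \<subseteq> positive_part B" for n
    using EB EU Upos by (fastforce simp: positive_part_def)
  ultimately show thesis using that[OF _ cover _ split] by blast
qed

text \<open>The intersection number of \<open>E n\<close> is controlled by the antichain bound of
  \<open>E n'\<close>, where the pieces land.\<close>

lemma strictly_positive_charge_exists:
  fixes E :: "nat \<Rightarrow> 'a set set"
  assumes E: "\<And>n. E n \<subseteq> positive_part B" "positive_part B \<subseteq> (\<Union>n. E n)"
    and bound: "\<And>n. \<exists>K :: nat. \<forall>A. antichain B A \<and> A \<subseteq> E n \<longrightarrow> finite A \<and> card A \<le> K"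
    and split: "\<And>n. \<exists>n'. \<forall>c1\<in>B. \<forall>c2\<in>B. \<forall>c3\<in>B. c1 \<union> c2 \<union> c3 \<in> E n \<longrightarrow>
      c1 \<in> E n' \<or> c2 \<in> E n' \<or> c3 \<in> E n'"
  shows "\<exists>\<mu>. charge \<mu> \<and> (\<forall>a\<in>positive_part B. 0 < \<mu> a)"
proof -
  have "\<exists>\<mu>. charge \<mu> \<and> (\<forall>a\<in>E n. 0 < \<mu> a)" for n
  proof -
    obtain n' where n': "\<And>c1 c2 c3. c1 \<in> B \<Longrightarrow> c2 \<in> B \<Longrightarrow> c3 \<in> B \<Longrightarrow> c1 \<union> c2 \<union> c3 \<in> E n \<Longrightarrow>
      c1 \<in> E n' \<or> c2 \<in> E n' \<or> c3 \<in> E n'"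
      using split by metis
    obtain r where r: "\<And>A. antichain B A \<Longrightarrow> A \<subseteq> E n' \<Longrightarrow> finite A \<and> card A \<le> r"
      using bound by metis
    have EB: "E n \<subseteq> B" using E(1)[of n] by (auto simp: positive_part_def)
    show ?thesis
    proof (rule intersection_number_charge[OF space_nonempty])
      show "1 \<le> 576 * (Suc r)\<^sup>2" by simp
      fix I :: "('a set \<times> nat) set" assume I: "finite I" "I \<noteq> {}" "fst ` I \<subseteq> E n"
      show "\<exists>x\<in>X. card I \<le> 576 * (Suc r)\<^sup>2 * card {i \<in> I. x \<in> fst i}"
        by (rule kalton_roberts_intersection[OF algebra_axioms r E(1)[of n'] EB n' I(1,2)])
          (use I(3) in auto)
    qed
  qed
  then have "\<exists>\<mu>. charge \<mu> \<and> (\<forall>a\<in>\<Union>n. E n. 0 < \<mu> a)" by (rule countable_mixture_charge)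
  then show ?thesis using E(2) by blast
qed

end

subsection \<open>Countable additivity\<close>

lemma charge_nonneg: "charge \<mu> \<Longrightarrow> 0 \<le> \<mu> a"
  by (simp add: charge_def)

lemma charge_Un: "charge \<mu> \<Longrightarrow> a \<inter> b = {} \<Longrightarrow> \<mu> (a \<union> b) = \<mu> a + \<mu> b"
  by (simp add: charge_def)

lemma charge_empty: "charge \<mu> \<Longrightarrow> \<mu> {} = 0"
  using charge_Un[of \<mu> "{}" "{}"] by simp

lemma charge_mono: "charge \<mu> \<Longrightarrow> a \<subseteq> b \<Longrightarrow> \<mu> a \<le> \<mu> b"
  using charge_Un[of \<mu> a "b - a"] charge_nonneg[of \<mu> "b - a"] by (simp add: Un_absorb1)

lemma charge_subadditive: "charge \<mu> \<Longrightarrow> \<mu> (a \<union> b) \<le> \<mu> a + \<mu> b"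
  using charge_Un[of \<mu> a "b - a"] charge_mono[of \<mu> "b - a" b] by simp

lemma charge_UN_le: "charge \<mu> \<Longrightarrow> \<mu> (\<Union>i<n. a i) \<le> (\<Sum>i<n. \<mu> (a i))" for n :: nat
proof (induction n)
  case (Suc n)
  have "\<mu> (\<Union>i<Suc n. a i) = \<mu> ((\<Union>i<n. a i) \<union> a n)" by (simp add: lessThan_Suc Un_commute)
  also have "\<dots> \<le> \<mu> (\<Union>i<n. a i) + \<mu> (a n)" using Suc.prems by (rule charge_subadditive)
  finally show ?case using Suc by simp
qed (simp add: charge_empty)

context boolean_sigma
begin

definition approx_bounds :: "('a set \<Rightarrow> real) \<Rightarrow> 'a set \<Rightarrow> real set" where
  "approx_bounds \<mu> a = {M. \<exists>c. increases_to c a \<and> (\<forall>k. \<mu> (c k) \<le> M)}"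

definition regularisation :: "('a set \<Rightarrow> real) \<Rightarrow> 'a set \<Rightarrow> real" where
  "regularisation \<mu> a = Inf (approx_bounds \<mu> a)"

lemma approx_bounds_nonempty: "a \<in> B \<Longrightarrow> \<mu> a \<in> approx_bounds \<mu> a"
  using increases_to_const by (auto simp: approx_bounds_def)

lemma approx_bounds_nonneg: "charge \<mu> \<Longrightarrow> M \<in> approx_bounds \<mu> a \<Longrightarrow> 0 \<le> M"
  unfolding approx_bounds_def using charge_nonneg order_trans by blast

lemma approx_bounds_bdd_below: "charge \<mu> \<Longrightarrow> bdd_below (approx_bounds \<mu> a)"
  using approx_bounds_nonneg by (intro bdd_belowI)

lemma regularisation_le:
  "charge \<mu> \<Longrightarrow> increases_to c a \<Longrightarrow> (\<And>k. \<mu> (c k) \<le> M) \<Longrightarrow> regularisation \<mu> a \<le> M"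
  unfolding regularisation_def
  by (rule cInf_lower[OF _ approx_bounds_bdd_below]) (auto simp: approx_bounds_def)

lemma regularisation_greatest:
  assumes "a \<in> B" "\<And>c M. increases_to c a \<Longrightarrow> (\<And>k. \<mu> (c k) \<le> M) \<Longrightarrow> z \<le> M"
  shows "z \<le> regularisation \<mu> a"
  unfolding regularisation_def using approx_bounds_nonempty[OF assms(1), of \<mu>] assms(2)
  by (intro cInf_greatest) (auto simp: approx_bounds_def)

lemma regularisation_lessD:
  assumes "a \<in> B" "regularisation \<mu> a < z"
  obtains c where "increases_to c a" "\<And>k. \<mu> (c k) \<le> z"
proof -
  obtain M where "M \<in> approx_bounds \<mu> a" "M < z"
    using cInf_lessD[of "approx_bounds \<mu> a" z] approx_bounds_nonempty[OF assms(1), of \<mu>] assms(2)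
    unfolding regularisation_def by blast
  then obtain c where "increases_to c a" "\<And>k. \<mu> (c k) \<le> M" by (auto simp: approx_bounds_def)
  then show thesis using \<open>M < z\<close> that by (meson less_eq_real_def order_trans)
qed

lemma regularisation_nonneg: "charge \<mu> \<Longrightarrow> a \<in> B \<Longrightarrow> 0 \<le> regularisation \<mu> a"
  using charge_nonneg order_trans by (intro regularisation_greatest) blast+

section \<open>Additivity and strict positivity of the regularisation\<close>

lemma regularisation_superadditive:
  assumes \<mu>: "charge \<mu>" and ab: "a \<in> B" "b \<in> B" "a \<inter> b = {}"
  shows "regularisation \<mu> a + regularisation \<mu> b \<le> regularisation \<mu> (a \<union> b)"
proof (rule regularisation_greatest)
  fix c M assume c: "increases_to c (a \<union> b)" "\<And>k. \<mu> (c k) \<le> M"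
  \<comment> \<open>Independent indices for the two parts allow the two infima to be bounded one
    after the other, first over \<open>i\<close> with \<open>j\<close> fixed.\<close>
  have sum: "\<mu> (c i \<inter> a) + \<mu> (c j \<inter> b) \<le> M" for i j
  proof -
    let ?k = "max i j"
    have "\<mu> (c i \<inter> a) \<le> \<mu> (c ?k \<inter> a)" "\<mu> (c j \<inter> b) \<le> \<mu> (c ?k \<inter> b)"
      using increases_toD(3)[OF c(1), of i ?k] increases_toD(3)[OF c(1), of j ?k]
      by (auto intro!: charge_mono[OF \<mu>])
    moreover have "\<mu> (c ?k \<inter> a) + \<mu> (c ?k \<inter> b) = \<mu> ((c ?k \<inter> a) \<union> (c ?k \<inter> b))"
      using ab by (intro charge_Un[OF \<mu>, symmetric]) blast
    moreover have "\<dots> \<le> \<mu> (c ?k)" by (intro charge_mono[OF \<mu>]) auto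
    ultimately show ?thesis using c(2)[of ?k] by linarith
  qed
  have a: "increases_to (\<lambda>k. c k \<inter> a) a"
    using increases_to_Int[OF c(1) ab(1)] by (simp add: Int_absorb1)
  have b: "increases_to (\<lambda>k. c k \<inter> b) b"
    using increases_to_Int[OF c(1) ab(2)] by (simp add: Int_absorb1)
  have "regularisation \<mu> a \<le> M - \<mu> (c j \<inter> b)" for j
    using sum[of _ j] by (intro regularisation_le[OF \<mu> a]) (simp add: algebra_simps)
  then have "regularisation \<mu> b \<le> M - regularisation \<mu> a"
    by (intro regularisation_le[OF \<mu> b]) (simp add: algebra_simps)
  then show "regularisation \<mu> a + regularisation \<mu> b \<le> M" by (simp add: algebra_simps)
qed (use ab in auto)

lemma regularisation_mono:
  assumes \<mu>: "charge \<mu>" and ab: "a \<in> B" "b \<in> B" "a \<subseteq> b"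
  shows "regularisation \<mu> a \<le> regularisation \<mu> b"
proof -
  have "regularisation \<mu> a + regularisation \<mu> (b - a) \<le> regularisation \<mu> (a \<union> (b - a))"
    using ab by (intro regularisation_superadditive[OF \<mu>]) auto
  moreover have "0 \<le> regularisation \<mu> (b - a)" using ab by (intro regularisation_nonneg[OF \<mu>]) auto
  ultimately show ?thesis using ab by (simp add: Un_absorb1)
qed

lemma regularisation_countably_subadditive:
  assumes \<mu>: "charge \<mu>" and a: "range a \<subseteq> B" and s: "summable (\<lambda>n. regularisation \<mu> (a n))"
  shows "regularisation \<mu> (bsup B (range a)) \<le> (\<Sum>n. regularisation \<mu> (a n))"
proof (rule field_le_epsilon)
  fix \<epsilon> :: real assume \<epsilon>: "0 < \<epsilon>"
  have aB: "a n \<in> B" for n using a by blast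
  define w where "w n = \<epsilon> * (1 / 2) ^ Suc n" for n
  have w: "w sums \<epsilon>" using sums_mult[OF power_half_series, of \<epsilon>] unfolding w_def by simp
  have w0: "0 < w n" for n using \<epsilon> by (simp add: w_def)
  have "\<exists>c. increases_to c (a n) \<and> (\<forall>k. \<mu> (c k) \<le> regularisation \<mu> (a n) + w n)" for n
    using regularisation_lessD[OF aB, of \<mu> n "regularisation \<mu> (a n) + w n"] w0 by (metis less_add_same_cancel1)
  then obtain c where c: "\<And>n. increases_to (c n) (a n)"
    "\<And>n k. \<mu> (c n k) \<le> regularisation \<mu> (a n) + w n" by metis
  have cB: "c n k \<in> B" for n k using increases_toD(1)[OF c(1)] .
  \<comment> \<open>Only finitely many sequences enter at each stage, so \<open>b k\<close> is in
    the algebra and finite subadditivity of \<open>\<mu>\<close> applies; every \<open>c n k\<close>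
    is still swallowed at a later stage.\<close>
  define b where "b k = (\<Union>n<k. c n k)" for k
  have countable: "countable (range a)" by simp
  have "increases_to b (bsup B (range a))"
    unfolding increases_to_def
  proof (intro conjI allI ballI impI)
    show "range b \<subseteq> B" using cB by (auto simp: b_def intro!: finite_UN)
    show "bsup B (range a) \<in> B" using a countable by (rule bsup_in)
    show "incseq b"
      unfolding incseq_def
    proof (intro allI impI)
      fix i j :: nat assume ij: "i \<le> j"
      have "c n i \<subseteq> c n j" for n using c(1) ij by (rule increases_toD(3))
      then show "b i \<subseteq> b j" using ij unfolding b_def by (intro UN_mono) auto
    qed
    show "b k \<subseteq> bsup B (range a)" for k
      unfolding b_def using increases_toD(4)[OF c(1)] bsup_upper[OF a countable] by blast
    fix u assume u: "u \<in> B" "\<forall>k. b k \<subseteq> u"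
    show "bsup B (range a) \<subseteq> u"
    proof (rule bsup_least[OF a countable u(1)])
      fix x assume "x \<in> range a"
      then obtain n where n: "x = a n" by blast
      have "c n k \<subseteq> u" for k
      proof -
        have "c n k \<subseteq> c n (max k (Suc n))" by (rule increases_toD(3)[OF c(1)]) simp
        also have "\<dots> \<subseteq> b (max k (Suc n))" unfolding b_def by (rule UN_upper) (simp add: less_max_iff_disj)
        finally show ?thesis using u(2) by blast
      qed
      then show "x \<subseteq> u" unfolding n by (rule increases_toD(5)[OF c(1) u(1)])
    qed
  qed
  moreover have "\<mu> (b k) \<le> (\<Sum>n. regularisation \<mu> (a n)) + \<epsilon>" for k
  proof -
    have "\<mu> (b k) \<le> (\<Sum>n<k. \<mu> (c n k))" unfolding b_def using \<mu> by (rule charge_UN_le)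
    also have "\<dots> \<le> (\<Sum>n<k. regularisation \<mu> (a n) + w n)" by (intro sum_mono c)
    also have "\<dots> = (\<Sum>n<k. regularisation \<mu> (a n)) + (\<Sum>n<k. w n)" by (rule sum.distrib)
    also have "\<dots> \<le> (\<Sum>n. regularisation \<mu> (a n)) + suminf w"
      using s w w0 regularisation_nonneg[OF \<mu> aB]
      by (intro add_mono sum_le_suminf) (auto simp: sums_iff less_imp_le)
    finally show ?thesis using w by (simp add: sums_iff)
  qed
  ultimately show "regularisation \<mu> (bsup B (range a)) \<le> (\<Sum>n. regularisation \<mu> (a n)) + \<epsilon>"
    by (rule regularisation_le[OF \<mu>])
qed

lemma regularisation_empty: "charge \<mu> \<Longrightarrow> regularisation \<mu> {} = 0"
  using regularisation_nonneg[of \<mu> "{}"] regularisation_le[OF _ increases_to_const, of \<mu> "{}" 0]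
  by (simp add: charge_empty)

lemma regularisation_Un:
  assumes \<mu>: "charge \<mu>" and ab: "a \<in> B" "b \<in> B" "a \<inter> b = {}"
  shows "regularisation \<mu> (a \<union> b) = regularisation \<mu> a + regularisation \<mu> b"
proof (rule antisym)
  \<comment> \<open>Padding with zeros makes finite subadditivity a case of the countable
    one.\<close>
  define f where "f n = (if n = 0 then a else if n = 1 then b else {})" for n :: nat
  have f: "range f \<subseteq> B" using ab by (auto simp: f_def)
  have "bsup B (range f) \<subseteq> a \<union> b"
    using f ab by (intro bsup_least) (auto simp: f_def split: if_splits)
  moreover have "f 0 \<subseteq> bsup B (range f)" "f 1 \<subseteq> bsup B (range f)"
    using f by (intro bsup_upper; simp)+
  ultimately have sup: "bsup B (range f) = a \<union> b" by (auto simp: f_def)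
  have "(\<lambda>n. regularisation \<mu> (f n)) sums (\<Sum>n\<in>{0, 1}. regularisation \<mu> (f n))"
    by (rule sums_finite) (auto simp: f_def regularisation_empty[OF \<mu>])
  then have "(\<lambda>n. regularisation \<mu> (f n)) sums (regularisation \<mu> a + regularisation \<mu> b)"
    by (simp add: f_def)
  then show "regularisation \<mu> (a \<union> b) \<le> regularisation \<mu> a + regularisation \<mu> b"
    using regularisation_countably_subadditive[OF \<mu> f] by (simp add: sup sums_iff)
qed (rule regularisation_superadditive[OF assms])

lemma regularisation_sums:
  assumes \<mu>: "charge \<mu>" and a: "range a \<subseteq> B" and disj: "disjoint_family a"
  shows "(\<lambda>n. regularisation \<mu> (a n)) sums regularisation \<mu> (bsup B (range a))"
proof -
  have aB: "a n \<in> B" for n using a by blast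
  have UB: "(\<Union>i<n. a i) \<in> B" for n using aB by (intro finite_UN) auto
  have fin: "(\<Sum>i<n. regularisation \<mu> (a i)) = regularisation \<mu> (\<Union>i<n. a i)" for n
  proof (induction n)
    case (Suc n)
    have "a i \<inter> a n = {}" if "i < n" for i
      using disj that by (simp add: disjoint_family_on_def)
    then have "(\<Union>i<n. a i) \<inter> a n = {}" by blast
    from regularisation_Un[OF \<mu> UB aB this] Suc show ?case
      by (simp add: lessThan_Suc Un_commute)
  qed (simp add: regularisation_empty[OF \<mu>])
  have le: "(\<Sum>i<n. regularisation \<mu> (a i)) \<le> regularisation \<mu> (bsup B (range a))" for n
    unfolding fin using bsup_upper[OF a] bsup_in[OF a] UB
    by (intro regularisation_mono[OF \<mu>]) auto
  have s: "summable (\<lambda>n. regularisation \<mu> (a n))"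
  proof (rule bounded_imp_summable)
    show "0 \<le> regularisation \<mu> (a n)" for n using regularisation_nonneg[OF \<mu> aB] .
    show "(\<Sum>i\<le>n. regularisation \<mu> (a i)) \<le> regularisation \<mu> (bsup B (range a))" for n
      using le[of "Suc n"] by (simp only: lessThan_Suc_atMost)
  qed
  have "(\<Sum>n. regularisation \<mu> (a n)) \<le> regularisation \<mu> (bsup B (range a))"
    using s le by (rule suminf_le_const)
  with regularisation_countably_subadditive[OF \<mu> a s] s show ?thesis by (simp add: sums_iff)
qed

text \<open>Were the value zero, there would be for each \<open>n\<close> a sequence increasing to
  \<open>a\<close> with charges at most \<open>(1 / 2) ^ n\<close>. The diagonal lemma picks one
  term from each so that the defects are below a null sequence \<open>d\<close>. Some nonzero
  \<open>a - d m\<close> then lies in all the later terms, so its charge is zero.\<close>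

lemma regularisation_pos:
  assumes wd: "weakly_distributive B" and ccc: "\<And>A. antichain B A \<Longrightarrow> countable A"
    and \<mu>: "charge \<mu>" "\<And>a. a \<in> positive_part B \<Longrightarrow> 0 < \<mu> a" and a: "a \<in> B" "a \<noteq> {}"
  shows "0 < regularisation \<mu> a"
proof (rule ccontr)
  assume "\<not> 0 < regularisation \<mu> a"
  then have small: "regularisation \<mu> a < (1 / 2) ^ n" for n :: nat
    by (smt (verit) zero_less_power half_gt_zero_iff)
  have "\<exists>c. increases_to c a \<and> (\<forall>k. \<mu> (c k) \<le> (1 / 2) ^ n)" for n
    using regularisation_lessD[OF a(1) small[of n]] by metis
  then obtain c where c: "\<And>n. increases_to (c n) a" "\<And>n k. \<mu> (c n k) \<le> (1 / 2) ^ n" by metis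
  obtain f where "conv_zero (\<lambda>n. a - c n (f n))"
    using weakly_distributive_diagonal[OF wd ccc, of "\<lambda>n k. a - c n k"]
      increases_to_imp_null_seq[OF c(1)] by auto
  then obtain d where d: "null_seq d" "\<And>n. a - c n (f n) \<subseteq> d n" by (auto simp: conv_zero_def)
  obtain m where "\<not> a \<subseteq> d m" using null_seqD(3)[OF d(1) a(1)] a(2) by blast
  then have "a - d m \<in> positive_part B" using null_seqD(1)[OF d(1)] a by (auto simp: positive_part_def)
  then have pos: "0 < \<mu> (a - d m)" by (rule \<mu>(2))
  have le: "\<mu> (a - d m) \<le> (1 / 2) ^ n" if "m \<le> n" for n
  proof -
    have "a - d m \<subseteq> c n (f n)" using d(2)[of n] null_seqD(2)[OF d(1) that] by blast
    then have "\<mu> (a - d m) \<le> \<mu> (c n (f n))" by (rule charge_mono[OF \<mu>(1)])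
    then show ?thesis using c(2)[of n "f n"] by simp
  qed
  obtain n where n: "(1 / 2 :: real) ^ n < \<mu> (a - d m)" using real_arch_pow_inv[OF pos, of "1 / 2"] by auto
  have "(1 / 2 :: real) ^ max m n \<le> (1 / 2) ^ n" by (rule power_decreasing) auto
  with le[of "max m n"] n show False by simp
qed

lemma measure_exists:
  assumes wd: "weakly_distributive B" and ccc: "\<And>A. antichain B A \<Longrightarrow> countable A"
    and \<mu>: "charge \<mu>" "\<And>a. a \<in> positive_part B \<Longrightarrow> 0 < \<mu> a"
  shows "\<exists>m. measure_on X B m"
proof -
  define N where "N = regularisation \<mu> X"
  have N: "0 < N" unfolding N_def using space_nonempty by (intro regularisation_pos[OF wd ccc \<mu>]) auto
  have "measure_on X B (\<lambda>a. regularisation \<mu> a / N)"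
    unfolding measure_on_def
  proof (intro conjI ballI allI impI)
    show "regularisation \<mu> {} / N = 0" by (simp add: regularisation_empty[OF \<mu>(1)])
    show "regularisation \<mu> X / N = 1" using N by (simp add: N_def)
    show "0 < regularisation \<mu> a / N" if "a \<in> B" "a \<noteq> {}" for a
      using that N by (intro divide_pos_pos regularisation_pos[OF wd ccc \<mu>])
    show "regularisation \<mu> a / N \<le> regularisation \<mu> b / N" if "a \<in> B" "b \<in> B" "a \<subseteq> b" for a b
      using that N by (intro divide_right_mono regularisation_mono[OF \<mu>(1)]) auto
    show "regularisation \<mu> (a \<union> b) / N = regularisation \<mu> a / N + regularisation \<mu> b / N"
      if "a \<in> B" "b \<in> B" "a \<inter> b = {}" for a b
      using regularisation_Un[OF \<mu>(1) that] by (simp add: add_divide_distrib)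
    show "(\<lambda>n. regularisation \<mu> (a n) / N) sums (regularisation \<mu> (bsup B (range a)) / N)"
      if "range a \<subseteq> B \<and> disjoint_family a" for a
      using that by (intro sums_divide regularisation_sums[OF \<mu>(1)]) auto
  qed
  then show ?thesis by blast
qed

end

subsection \<open>Measure algebras\<close>

context boolean_sigma
begin

lemma measure_onD:
  assumes "measure_on X B m"
  shows "m {} = 0" "a \<in> B \<Longrightarrow> a \<noteq> {} \<Longrightarrow> 0 < m a" "m X = 1"
    "a \<in> B \<Longrightarrow> b \<in> B \<Longrightarrow> a \<subseteq> b \<Longrightarrow> m a \<le> m b"
    "a \<in> B \<Longrightarrow> b \<in> B \<Longrightarrow> a \<inter> b = {} \<Longrightarrow> m (a \<union> b) = m a + m b"
    "range f \<subseteq> B \<Longrightarrow> disjoint_family f \<Longrightarrow> (\<lambda>n. m (f n)) sums m (bsup B (range f))"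
  using assms by (simp_all add: measure_on_def)

lemma measure_on_nonneg: "measure_on X B m \<Longrightarrow> a \<in> B \<Longrightarrow> 0 \<le> m a"
  using measure_onD(1)[of m] measure_onD(2)[of m a] by (cases "a = {}") (auto simp: less_imp_le)

lemma measure_on_Diff:
  assumes "measure_on X B m" "a \<in> B" "b \<in> B" "a \<subseteq> b"
  shows "m (b - a) = m b - m a"
  using measure_onD(5)[OF assms(1,2), of "b - a"] Diff[OF assms(3,2)] assms(4)
  by (simp add: Un_absorb1)

text \<open>Disjointing a sequence keeps its union, hence its upper bounds in \<open>B\<close>,
  while each term only shrinks.\<close>

lemma measure_on_countably_subadditive:
  assumes m: "measure_on X B m" and a: "range a \<subseteq> B" and s: "summable (\<lambda>n. m (a n))"
  shows "m (bsup B (range a)) \<le> (\<Sum>n. m (a n))"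
proof -
  have d: "range (disjointed a) \<subseteq> B" using a by (rule range_disjointed_sets)
  have sums: "(\<lambda>n. m (disjointed a n)) sums m (bsup B (range (disjointed a)))"
    using m d disjoint_family_disjointed by (rule measure_onD(6))
  have "bsup B (range a) \<subseteq> bsup B (range (disjointed a))"
  proof (rule bsup_least[OF a])
    show "bsup B (range (disjointed a)) \<in> B" using d by (rule bsup_in) simp
    fix x assume "x \<in> range a"
    then have "x \<subseteq> (\<Union>n. disjointed a n)" unfolding UN_disjointed_eq by blast
    also have "\<dots> \<subseteq> bsup B (range (disjointed a))" using bsup_upper[OF d] by (intro UN_least) simp
    finally show "x \<subseteq> bsup B (range (disjointed a))" .
  qed simp
  then have "m (bsup B (range a)) \<le> m (bsup B (range (disjointed a)))"
    using a d by (intro measure_onD(4)[OF m] bsup_in) simp_all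
  also have "\<dots> = (\<Sum>n. m (disjointed a n))" using sums by (simp add: sums_iff)
  also have "\<dots> \<le> (\<Sum>n. m (a n))"
  proof (rule suminf_le[OF _ _ s])
    show "m (disjointed a n) \<le> m (a n)" for n
      using a d by (intro measure_onD(4)[OF m] disjointed_subset) auto
    show "summable (\<lambda>n. m (disjointed a n))" using sums by (simp add: sums_iff)
  qed
  finally show ?thesis .
qed

lemma measure_on_geometric_bound:
  assumes m: "measure_on X B m" and a: "range a \<subseteq> B" and le: "\<And>n. m (a n) \<le> r * (1 / 2) ^ n"
  shows "m (bsup B (range a)) \<le> 2 * r"
proof -
  have "(\<lambda>n. r * (1 / 2) ^ n) sums (r * (1 / (1 - 1 / 2)))"
    by (intro sums_mult geometric_sums) simp
  then have geo: "(\<lambda>n. r * (1 / 2) ^ n) sums (2 * r)" by (simp add: mult.commute)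
  have s: "summable (\<lambda>n. m (a n))"
  proof (rule summable_comparison_test')
    show "summable (\<lambda>n. r * (1 / 2) ^ n)" using geo by (rule sums_summable)
    show "norm (m (a n)) \<le> r * (1 / 2) ^ n" for n
      using le[of n] measure_on_nonneg[OF m, of "a n"] a by (simp add: image_subset_iff)
  qed
  have "m (bsup B (range a)) \<le> (\<Sum>n. m (a n))" by (rule measure_on_countably_subadditive[OF m a s])
  also have "\<dots> \<le> (\<Sum>n. r * (1 / 2) ^ n)" using le s sums_summable[OF geo] by (rule suminf_le)
  also have "\<dots> = 2 * r" using geo by (rule sums_unique[symmetric])
  finally show ?thesis .
qed

text \<open>The layers have supremum \<open>d 0\<close>, because the remainder is below every
  \<open>d n\<close>. Their measures telescope, so convergence of the series to
  \<open>m (d 0)\<close> is the claim.\<close>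

lemma measure_on_null_seq:
  assumes m: "measure_on X B m" and d: "null_seq d"
  shows "(\<lambda>n. m (d n)) \<longlonglongrightarrow> 0"
proof -
  have dB: "d n \<in> B" for n using null_seqD(1)[OF d] .
  define L where "L k = d k - d (Suc k)" for k
  have L: "range L \<subseteq> B" using dB by (auto simp: L_def)
  have up: "L k \<subseteq> bsup B (range L)" for k using L by (rule bsup_upper) simp_all
  have sB: "bsup B (range L) \<in> B" using L by (rule bsup_in) simp
  have "d 0 - bsup B (range L) = {}"
  proof (rule null_seqD(3)[OF d])
    show "d 0 - bsup B (range L) \<in> B" using dB sB by blast
    show "d 0 - bsup B (range L) \<subseteq> d n" for n
    proof (induction n)
      case (Suc n)
      then show ?case using up[of n] by (auto simp: L_def)
    qed blast
  qed
  moreover have "bsup B (range L) \<subseteq> d 0"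
    using null_seqD(2)[OF d, of 0] by (intro bsup_least[OF L _ dB]) (auto simp: L_def)
  ultimately have "bsup B (range L) = d 0" by blast
  moreover have "disjoint_family L"
    using null_seq_layers_disjoint[OF d] by (simp add: disjoint_family_on_def L_def)
  ultimately have "(\<lambda>k. m (L k)) sums m (d 0)" using measure_onD(6)[OF m L] by simp
  moreover have "m (L k) = m (d k) - m (d (Suc k))" for k
    unfolding L_def using dB null_seqD(2)[OF d] by (intro measure_on_Diff[OF m]) auto
  then have "(\<Sum>k<n. m (L k)) = m (d 0) - m (d n)" for n by (induction n) simp_all
  ultimately have "(\<lambda>n. m (d 0) - m (d n)) \<longlonglongrightarrow> m (d 0)" by (simp add: sums_def)
  from tendsto_diff[OF tendsto_const[of "m (d 0)"] this] show ?thesis by simp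
qed

lemma measure_on_antichain_card:
  assumes m: "measure_on X B m" and A: "antichain B A" "\<And>a. a \<in> A \<Longrightarrow> (1 / 2) ^ n \<le> m a"
  shows "finite A \<and> card A \<le> 2 ^ n"
proof (rule finite_if_finite_subsets_card_bdd)
  fix G assume G: "finite G" "G \<subseteq> A"
  have AB: "A \<subseteq> B" using A(1) by (auto simp: antichain_def positive_part_def)
  have "m (\<Union>G) = (\<Sum>a\<in>G. m a) \<and> \<Union>G \<in> B"
    using G
  proof (induction G rule: finite_induct)
    case (insert a G)
    then have IH: "m (\<Union>G) = (\<Sum>a\<in>G. m a)" "\<Union>G \<in> B" and aB: "a \<in> B" using AB by auto
    have "a \<inter> b = {}" if "b \<in> G" for b
      using A(1) insert that unfolding antichain_def by (metis insert_subset subsetD)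
    then have "a \<inter> \<Union>G = {}" by blast
    from measure_onD(5)[OF m aB IH(2) this] IH aB insert.hyps show ?case by auto
  qed (simp add: measure_onD(1)[OF m])
  then have "(\<Sum>a\<in>G. m a) \<le> 1"
    using measure_onD(4)[OF m, of "\<Union>G" X] subset_space measure_onD(3)[OF m] by force
  moreover have "(\<Sum>a\<in>G. (1 / 2) ^ n) \<le> (\<Sum>a\<in>G. m a)" using A(2) G by (intro sum_mono) auto
  ultimately have "real (card G) * (1 / 2) ^ n \<le> 1" by simp
  then have "real (card G) \<le> real (2 ^ n)" by (simp add: power_one_over field_simps)
  then show "card G \<le> 2 ^ n" by (simp only: of_nat_le_iff)
qed

text \<open>The first Borel-Cantelli lemma: the supremum of the tail from \<open>n\<close> has
  measure at most \<open>2 * (1 / 2) ^ n\<close>, so a common lower bound has measure zero and is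
  zero by strict positivity.\<close>

lemma measure_on_conv_zero:
  assumes m: "measure_on X B m" and a: "\<And>n. a n \<in> B" "\<And>n. m (a n) < (1 / 2) ^ n"
  shows "conv_zero a"
proof -
  define D where "D n = bsup B (range (\<lambda>k. a (n + k)))" for n
  have ran: "range (\<lambda>k. a (n + k)) \<subseteq> B" for n using a by blast
  have DB: "D n \<in> B" for n unfolding D_def using ran by (rule bsup_in) simp
  have up: "a k \<subseteq> D n" if "n \<le> k" for n k
    unfolding D_def using ran
    by (rule bsup_upper) (auto intro!: range_eqI[of _ _ "k - n"] simp: that)
  have "m (a (n + k)) \<le> (1 / 2) ^ n * (1 / 2) ^ k" for n k
    using a(2)[of "n + k"] by (simp add: power_add)
  then have mD: "m (D n) \<le> 2 * (1 / 2) ^ n" for n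
    unfolding D_def by (rule measure_on_geometric_bound[OF m ran])
  have "null_seq D"
    unfolding null_seq_def
  proof (intro conjI ballI impI)
    show "decseq D"
      unfolding decseq_def
    proof (intro allI impI)
      fix i j :: nat assume "i \<le> j"
      then have "a (j + k) \<subseteq> D i" for k by (intro up) simp
      then show "D j \<subseteq> D i"
        unfolding D_def[of j] by (intro bsup_least[OF ran _ DB]) auto
    qed
    fix l assume l: "l \<in> B" "\<forall>n. l \<subseteq> D n"
    have "m l \<le> 2 * (1 / 2) ^ n" for n
      using measure_onD(4)[OF m l(1) DB, of n] l(2) mD[of n] by force
    moreover have "(\<lambda>n. 2 * (1 / 2) ^ n :: real) \<longlonglongrightarrow> 2 * 0"
      by (intro tendsto_mult_left LIMSEQ_power_zero) simp
    ultimately have "m l \<le> 2 * 0" by (intro LIMSEQ_le_const[of "\<lambda>n. 2 * (1 / 2) ^ n"]) blast+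
    then show "l = {}" using measure_onD(2)[OF m l(1)] by force
  qed (use DB in auto)
  then show ?thesis unfolding conv_zero_def using up by blast
qed

lemma positive_part_eq_measure_levels:
  assumes m: "measure_on X B m"
  shows "positive_part B = (\<Union>n. {a \<in> B. (1 / 2) ^ n \<le> m a})"
proof (intro equalityI subsetI)
  fix a assume "a \<in> positive_part B"
  then have a: "a \<in> B" "0 < m a" using measure_onD(2)[OF m] by (auto simp: positive_part_def)
  obtain n where "(1 / 2) ^ n < m a" using real_arch_pow_inv[OF a(2), of "1 / 2"] by auto
  then show "a \<in> (\<Union>n. {a \<in> B. (1 / 2) ^ n \<le> m a})"
    using a by (auto intro!: exI[of _ n] less_imp_le)
next
  fix a assume "a \<in> (\<Union>n. {a \<in> B. (1 / 2) ^ n \<le> m a})"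
  then obtain n :: nat where a: "a \<in> B" "(1 / 2) ^ n \<le> m a" by blast
  have "(0 :: real) < (1 / 2) ^ n" by simp
  then have "m a \<noteq> 0" using a(2) by linarith
  then have "a \<noteq> {}" using measure_onD(1)[OF m] by auto
  then show "a \<in> positive_part B" using a by (simp add: positive_part_def)
qed

section \<open>Partitions in a measure algebra\<close>

lemma measure_on_countable_antichain:
  assumes m: "measure_on X B m" and A: "antichain B A"
  shows "countable A"
proof (rule bounded_antichains_imp_countable[where C = "\<lambda>n. {a \<in> B. (1 / 2) ^ n \<le> m a}", OF _ _ A])
  show "\<exists>K :: nat. \<forall>A. antichain B A \<and> A \<subseteq> {a \<in> B. (1 / 2) ^ n \<le> m a} \<longrightarrow> finite A \<and> card A \<le> K"
    for n :: nat
    using measure_on_antichain_card[OF m, of _ n] by blast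
qed (use positive_part_eq_measure_levels[OF m] in simp)

text \<open>Along an enumeration of \<open>W\<close> the complements of the finite unions form a
  null sequence, even where the union of all of \<open>W\<close> is smaller than
  \<open>X\<close>.\<close>

lemma unit_partition_finite_approximation:
  assumes m: "measure_on X B m" and W: "unit_partition B W" and \<epsilon>: "0 < \<epsilon>"
  obtains F where "finite F" "F \<subseteq> W" "m (X - \<Union>F) < \<epsilon>"
proof -
  have WB: "W \<subseteq> B" and cW: "countable W"
    using W measure_on_countable_antichain[OF m]
    by (auto simp: unit_partition_def antichain_def positive_part_def)
  have "W \<noteq> {}" using unit_partition_disjoint[OF W, of X] space_nonempty by auto
  define w where "w = from_nat_into W"
  have w: "w i \<in> W" for i unfolding w_def using \<open>W \<noteq> {}\<close> by (rule from_nat_into)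
  define d where "d n = X - (\<Union>i<n. w i)" for n
  have "null_seq d"
    unfolding null_seq_def
  proof (intro conjI ballI impI)
    have "(\<Union>i<n. w i) \<in> B" for n using w WB by (intro finite_UN) auto
    then show "range d \<subseteq> B" unfolding d_def using compl_sets by blast
    show "decseq d" unfolding decseq_def d_def by (auto intro: order.strict_trans2)
    fix l assume l: "l \<in> B" "\<forall>n. l \<subseteq> d n"
    show "l = {}"
    proof (rule unit_partition_disjoint[OF W l(1)])
      fix v assume "v \<in> W"
      then obtain i where "v = w i" unfolding w_def using from_nat_into_surj[OF cW] by metis
      then show "l \<inter> v = {}" using l(2)[rule_format, of "Suc i"] by (auto simp: d_def)
    qed
  qed
  then have "(\<lambda>n. m (d n)) \<longlonglongrightarrow> 0" by (rule measure_on_null_seq[OF m])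
  then have "\<forall>\<^sub>F n in sequentially. m (d n) < \<epsilon>" using \<epsilon> by (rule order_tendstoD(2))
  then obtain n where "m (d n) < \<epsilon>" by (auto simp: eventually_sequentially)
  then show thesis using that[of "w ` {..<n}"] w by (auto simp: d_def)
qed

text \<open>An antichain maximal among those inside \<open>G\<close> is maximal among all
  antichains: a further element would contain a member of \<open>G\<close> that could be added
  first.\<close>

lemma unit_partition_of_dense:
  assumes G: "G \<subseteq> positive_part B"
    and dense: "\<And>b. b \<in> positive_part B \<Longrightarrow> \<exists>v\<in>G. v \<subseteq> b"
  obtains V where "unit_partition B V" "V \<subseteq> G"
proof -
  define \<A> where "\<A> = {V. antichain B V \<and> V \<subseteq> G}"
  have "\<exists>M\<in>\<A>. \<forall>V\<in>\<A>. M \<subseteq> V \<longrightarrow> V = M"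
  proof (rule subset_Zorn')
    fix \<C> assume "subset.chain \<A> \<C>"
    then have *: "\<C> \<subseteq> \<A>" "\<And>U V. U \<in> \<C> \<Longrightarrow> V \<in> \<C> \<Longrightarrow> U \<subseteq> V \<or> V \<subseteq> U"
      by (auto simp: subset_chain_def)
    have "a \<inter> b = {}" if ab: "a \<in> \<Union>\<C>" "b \<in> \<Union>\<C>" "a \<noteq> b" for a b
    proof -
      obtain U V where UV: "U \<in> \<C>" "V \<in> \<C>" "a \<in> U" "b \<in> V" using ab by blast
      have anti: "antichain B U" "antichain B V" using UV *(1) by (auto simp: \<A>_def)
      from *(2)[OF UV(1,2)] show ?thesis
      proof
        assume "U \<subseteq> V"
        then have "a \<in> V" using UV by blast
        then show ?thesis using anti(2) UV ab(3) by (simp add: antichain_def)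
      next
        assume "V \<subseteq> U"
        then have "b \<in> U" using UV by blast
        then show ?thesis using anti(1) UV ab(3) by (simp add: antichain_def)
      qed
    qed
    moreover have "\<Union>\<C> \<subseteq> G" using *(1) by (auto simp: \<A>_def)
    ultimately show "\<Union>\<C> \<in> \<A>" using G by (auto simp: \<A>_def antichain_def)
  qed
  then obtain V where V: "antichain B V" "V \<subseteq> G"
    and max: "\<And>U. antichain B U \<Longrightarrow> U \<subseteq> G \<Longrightarrow> V \<subseteq> U \<Longrightarrow> U = V"
    by (auto simp: \<A>_def)
  have "unit_partition B V"
    unfolding unit_partition_def
  proof (intro conjI allI impI V)
    fix W assume W: "antichain B W \<and> V \<subseteq> W"
    have "x \<in> V" if x: "x \<in> W" for x
    proof (rule ccontr)
      assume nx: "x \<notin> V"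
      have "x \<in> positive_part B" using x W by (auto simp: antichain_def)
      then obtain v where v: "v \<in> G" "v \<subseteq> x" using dense by blast
      have disj: "v \<inter> u = {}" "u \<inter> v = {}" if "u \<in> V" for u
      proof -
        have "x \<inter> u = {}" using W x nx that unfolding antichain_def by (metis subsetD)
        then show "v \<inter> u = {}" "u \<inter> v = {}" using v by auto
      qed
      have "antichain B (insert v V)" using V(1) v G disj by (auto simp: antichain_def)
      then have "insert v V = V" using V(2) v by (intro max) auto
      then have "v \<in> V" by blast
      then have "v = {}" using disj by blast
      then show False using v G by (auto simp: positive_part_def)
    qed
    then show "W = V" using W by blast
  qed
  then show thesis using V(2) that by blast
qed

text \<open>It suffices that the elements meeting finitely many members of each \<open>W n\<close>
  are dense. Such an element below \<open>b\<close> arises by removing everything outside finite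
  parts \<open>F n\<close> of the partitions.\<close>

lemma measure_on_weakly_distributive:
  assumes m: "measure_on X B m"
  shows "weakly_distributive B"
  unfolding weakly_distributive_def
proof (intro allI impI)
  fix W :: "nat \<Rightarrow> 'a set set" assume W: "\<forall>n. unit_partition B (W n)"
  have WB: "W n \<subseteq> B" for n using W by (auto simp: unit_partition_def antichain_def positive_part_def)
  have Wdisj: "v \<inter> w = {}" if "v \<in> W n" "w \<in> W n" "v \<noteq> w" for v w n
    using W that by (simp add: unit_partition_def antichain_def)
  define G where "G = {v \<in> positive_part B. \<forall>n. finite {w \<in> W n. v \<inter> w \<noteq> {}}}"
  have dense: "\<exists>v\<in>G. v \<subseteq> b" if b: "b \<in> positive_part B" for b
  proof -
    have bB: "b \<in> B" and mb: "0 < m b"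
      using b measure_onD(2)[OF m] by (auto simp: positive_part_def)
    \<comment> \<open>These bounds add up to \<open>m b / 2\<close>, so the removal cannot exhaust
      \<open>b\<close>.\<close>
    have "\<exists>F. finite F \<and> F \<subseteq> W n \<and> m (X - \<Union>F) < m b / 4 * (1 / 2) ^ n" for n
    proof -
      have "0 < m b / 4 * (1 / 2) ^ n" using mb by simp
      then show ?thesis using unit_partition_finite_approximation[OF m] W by metis
    qed
    then obtain F where F: "\<And>n. finite (F n)" "\<And>n. F n \<subseteq> W n"
      "\<And>n. m (X - \<Union>(F n)) < m b / 4 * (1 / 2) ^ n" by metis
    have "\<Union>(F n) \<in> B" for n using F(1,2) WB by (meson finite_Union subset_trans)
    then have ran: "range (\<lambda>n. X - \<Union>(F n)) \<subseteq> B" using compl_sets by blast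
    define s where "s = bsup B (range (\<lambda>n. X - \<Union>(F n)))"
    have sB: "s \<in> B" unfolding s_def using ran by (rule bsup_in) simp
    have "m s \<le> 2 * (m b / 4)"
      unfolding s_def using F(3) by (intro measure_on_geometric_bound[OF m ran]) (simp add: less_imp_le)
    then have "\<not> b \<subseteq> s" using measure_onD(4)[OF m bB sB] mb by linarith
    then have "b - s \<in> positive_part B" using bB sB by (auto simp: positive_part_def)
    moreover have "finite {w \<in> W n. (b - s) \<inter> w \<noteq> {}}" for n
    proof (rule finite_subset[OF _ F(1)[of n]])
      have "X - \<Union>(F n) \<subseteq> s" unfolding s_def using ran by (rule bsup_upper) simp_all
      then have sub: "b - s \<subseteq> \<Union>(F n)" using subset_space[OF bB] by blast
      show "{w \<in> W n. (b - s) \<inter> w \<noteq> {}} \<subseteq> F n"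
      proof
        fix w assume w: "w \<in> {w \<in> W n. (b - s) \<inter> w \<noteq> {}}"
        then obtain v where v: "v \<in> F n" "v \<inter> w \<noteq> {}" using sub by blast
        then have "v = w" using Wdisj F(2) w by blast
        then show "w \<in> F n" using v by simp
      qed
    qed
    ultimately have "b - s \<in> G" by (simp add: G_def)
    then show ?thesis by blast
  qed
  have "G \<subseteq> positive_part B" by (auto simp: G_def)
  from unit_partition_of_dense[OF this dense] obtain V where "unit_partition B V" "V \<subseteq> G" .
  then show "\<exists>V. unit_partition B V \<and> (\<forall>a\<in>V. \<forall>n. finite {b \<in> W n. a \<inter> b \<noteq> {}})"
    by (auto simp: G_def)
qed

end

theorem theorem1p2:
  fixes X :: "'a set" and B :: "'a set set"
  assumes "boolean_sigma_algebra X B"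
  shows "measure_algebra X B \<longleftrightarrow>
    weakly_distributive B \<and>
    (\<exists>C :: nat \<Rightarrow> 'a set set.
       (\<forall>n. C n \<subseteq> positive_part B) \<and>
       positive_part B = (\<Union>n. C n) \<and>
       (\<forall>n. \<exists>K :: nat. \<forall>A. antichain B A \<and> A \<subseteq> C n \<longrightarrow> finite A \<and> card A \<le> K) \<and>
       (\<forall>a :: nat \<Rightarrow> 'a set. (\<forall>n. a n \<in> B) \<and> (\<forall>n. a n \<notin> C n) \<longrightarrow> blim B a {}))"
proof -
  interpret boolean_sigma X B using assms by unfold_locales
  show ?thesis
  proof (rule iffI; (elim conjE exE)?)
    assume "measure_algebra X B"
    then obtain m where m: "measure_on X B m" by (auto simp: measure_algebra_def)
    \<comment> \<open>Powers of 1/2 serve as levels because they are summable: a sequence with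
      \<open>a n\<close> outside \<open>C n\<close> then falls under the Borel-Cantelli
      argument.\<close>
    define C where "C n = {a \<in> B. (1 / 2) ^ n \<le> m a}" for n :: nat
    show "weakly_distributive B \<and> (\<exists>C :: nat \<Rightarrow> 'a set set.
       (\<forall>n. C n \<subseteq> positive_part B) \<and> positive_part B = (\<Union>n. C n) \<and>
       (\<forall>n. \<exists>K :: nat. \<forall>A. antichain B A \<and> A \<subseteq> C n \<longrightarrow> finite A \<and> card A \<le> K) \<and>
       (\<forall>a :: nat \<Rightarrow> 'a set. (\<forall>n. a n \<in> B) \<and> (\<forall>n. a n \<notin> C n) \<longrightarrow> blim B a {}))"
    proof (intro conjI exI[of _ C] allI impI)
      show "weakly_distributive B" by (rule measure_on_weakly_distributive[OF m])
      show cover: "positive_part B = (\<Union>n. C n)"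
        unfolding C_def by (rule positive_part_eq_measure_levels[OF m])
      show "C n \<subseteq> positive_part B" for n unfolding cover by (rule UN_upper) simp
      show "\<exists>K :: nat. \<forall>A. antichain B A \<and> A \<subseteq> C n \<longrightarrow> finite A \<and> card A \<le> K" for n
        using measure_on_antichain_card[OF m, of _ n] unfolding C_def by blast
      show "blim B a {}" if a: "(\<forall>n. a n \<in> B) \<and> (\<forall>n. a n \<notin> C n)" for a
      proof -
        have "conv_zero a" using a by (intro measure_on_conv_zero[OF m]) (auto simp: C_def not_le)
        then show ?thesis using blim_zero_iff[of a] a by blast
      qed
    qed
  next
    fix C :: "nat \<Rightarrow> 'a set set"
    assume wd: "weakly_distributive B" and C: "\<forall>n. C n \<subseteq> positive_part B" "positive_part B = (\<Union>n. C n)"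
      and bound: "\<forall>n. \<exists>K :: nat. \<forall>A. antichain B A \<and> A \<subseteq> C n \<longrightarrow> finite A \<and> card A \<le> K"
      and conv: "\<forall>a :: nat \<Rightarrow> 'a set. (\<forall>n. a n \<in> B) \<and> (\<forall>n. a n \<notin> C n) \<longrightarrow> blim B a {}"
    have ccc: "countable A" if "antichain B A" for A
      using bounded_antichains_imp_countable[of B C A] bound C(2) that by blast
    have conv': "conv_zero a" if "\<And>n. a n \<in> B" "\<And>n. a n \<notin> C n" for a
      using conv blim_zero_iff[of a] that by blast
    show "measure_algebra X B"
    proof (rule regular_fragmentation[OF wd C(1)[rule_format] C(2) bound[rule_format] conv'])
      fix E :: "nat \<Rightarrow> 'a set set"
      assume E: "\<And>n. E n \<subseteq> positive_part B" "positive_part B \<subseteq> (\<Union>n. E n)"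
        "\<And>n. \<exists>K :: nat. \<forall>A. antichain B A \<and> A \<subseteq> E n \<longrightarrow> finite A \<and> card A \<le> K"
        "\<And>n. \<exists>n'. \<forall>c1\<in>B. \<forall>c2\<in>B. \<forall>c3\<in>B. c1 \<union> c2 \<union> c3 \<in> E n \<longrightarrow>
          c1 \<in> E n' \<or> c2 \<in> E n' \<or> c3 \<in> E n'"
      obtain \<mu> where "charge \<mu>" "\<forall>a\<in>positive_part B. 0 < \<mu> a"
        using strictly_positive_charge_exists[OF E] by blast
      then have "\<exists>m. measure_on X B m" using measure_exists[OF wd ccc] by blast
      then show "measure_algebra X B" using bsa by (simp add: measure_algebra_def)
    qed
  qed
qed

end
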